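(* Let $(\mathcal{M},\varphi_\alpha,\xi_\alpha,\eta_\alpha,g)$, $\alpha=1,2,3$, be a $(4n+3)$-dimensional smooth manifold with cosymplectic HN-metric 3-structure, i.e. a manifold with almost contact HN-metric 3-structure such that $F_\alpha=0$ for all $\alpha=1,2,3$, where $F_\alpha(x,y,z)=g((\nabla_x\varphi_\alpha)y,z)$ and $\nabla$ is the Levi-Civita connection of $g$. Then $\mathcal{M}$ is flat, i.e. the curvature tensor $R$ of $\nabla$, $R(x,y)z=[\nabla_x,\nabla_y]z-\nabla_{[x,y]}z$, vanishes identically.
   Context: An almost contact 3-structure on a $(4n+3)$-dimensional smooth manifold $\mathcal{M}$ consists of three endomorphisms $\varphi_\alpha$ of the tangent bundle, three vector fields $\xi_\alpha$ (Reeb vector fields) and three 1-forms $\eta_\alpha$ ($\alpha=1,2,3$) such that for all $\alpha,\beta\in\{1,2,3\}$ (with summation over $\gamma\in\{1,2,3\}$) $$\varphi_\alpha\circ\varphi_\beta=-\delta_{\alpha\beta}I+\xi_\alpha\otimes\eta_\beta+\epsilon_{\alpha\beta\gamma}\varphi_\gamma,\qquad \varphi_\alpha\xi_\beta=\epsilon_{\alpha\beta\gamma}\xi_\gamma,\qquad \eta_\alpha\circ\varphi_\beta=\epsilon_{\alpha\beta\gamma}\eta_\gamma,\qquad \eta_\alpha(\xi_\beta)=\delta_{\alpha\beta},$$ where $I$ is the identity, $(\xi_\alpha\otimes\eta_\beta)(x)=\eta_\beta(x)\xi_\alpha$, $\delta_{\alpha\beta}$ is the Kronecker delta and $\epsilon_{\alpha\beta\gamma}$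 is the Levi-Civita symbol. A pseudo-Riemannian metric $g$ on such a manifold is an HN-metric (metric of Hermitian-Norden type) if for all vector fields $x,y$ and all $\alpha=1,2,3$ $$g(\varphi_\alpha x,\varphi_\alpha y)=\varepsilon_\alpha\, g(x,y)+\eta_\alpha(x)\eta_\alpha(y),$$ for some cyclic permutation $(\varepsilon_1,\varepsilon_2,\varepsilon_3)$ of $(1,-1,-1)$; for definiteness the convention is $\varepsilon_1=1$, $\varepsilon_2=\varepsilon_3=-1$. Then $(\varphi_\alpha,\xi_\alpha,\eta_\alpha,g)$ is called an almost contact HN-metric 3-structure. *)

theory Defs
  imports "HOL-Analysis.Analysis" "HOL-Library.Function_Algebras"
begin

text \<open>
  Functionals on functions and sections of such functionals are added pointwise
  (\<^theory>\<open>HOL-Library.Function_Algebras\<close>); the following instance adds pointwise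
  multiplication by real scalars.
\<close>

instantiation "fun" :: (type, real_vector) real_vector
begin

definition scaleR_fun :: "real \<Rightarrow> ('a \<Rightarrow> 'b) \<Rightarrow> 'a \<Rightarrow> 'b"
  where "scaleR_fun c f = (\<lambda>x. c *\<^sub>R f x)"

instance
  by standard (simp_all add: scaleR_fun_def fun_eq_iff scaleR_add_right scaleR_add_left)

end

lemma scaleR_fun_apply [simp]: "(c *\<^sub>R f) x = c *\<^sub>R f x"
  by (simp add: scaleR_fun_def)


section \<open>Smooth manifolds\<close>

text \<open>\<open>Ck_on k S f\<close>: all iterated partial derivatives of \<open>f\<close> of order at most \<open>k\<close> exist and
  are continuous on the open set \<open>S\<close>.\<close>

fun Ck_on :: "nat \<Rightarrow> 'e::euclidean_space set \<Rightarrow> ('e \<Rightarrow> 'b::real_normed_vector) \<Rightarrow> bool" where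
  "Ck_on 0 S f \<longleftrightarrow> continuous_on S f"
| "Ck_on (Suc k) S f \<longleftrightarrow> (\<forall>x\<in>S. f differentiable (at x)) \<and>
     (\<forall>i\<in>Basis. Ck_on k S (\<lambda>x. frechet_derivative f (at x) i))"

definition smooth_on :: "'e::euclidean_space set \<Rightarrow> ('e \<Rightarrow> 'b::real_normed_vector) \<Rightarrow> bool" where
  "smooth_on S f \<longleftrightarrow> (\<forall>k. Ck_on k S f)"

type_synonym ('m, 'e) chart = "'m set \<times> ('m \<Rightarrow> 'e)"

definition is_chart :: "('m::topological_space, 'e::euclidean_space) chart \<Rightarrow> bool" where
  "is_chart c \<longleftrightarrow> (case c of (U, \<psi>) \<Rightarrow>
     open U \<and> open (\<psi> ` U) \<and> homeomorphism U (\<psi> ` U) \<psi> (inv_into U \<psi>))"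

definition smooth_compatible ::
  "('m, 'e::euclidean_space) chart \<Rightarrow> ('m, 'e) chart \<Rightarrow> bool" where
  "smooth_compatible c d \<longleftrightarrow> (case c of (U, \<psi>) \<Rightarrow> case d of (V, \<theta>) \<Rightarrow>
     smooth_on (\<psi> ` (U \<inter> V)) (\<theta> \<circ> inv_into U \<psi>))"

text \<open>The manifold is the whole type \<open>'m\<close>, which is Hausdorff and second countable; its
  dimension is \<open>DIM('e)\<close>.  The atlas need not be maximal.\<close>

definition smooth_manifold ::
  "('m::{t2_space,second_countable_topology}, 'e::euclidean_space) chart set \<Rightarrow> bool" where
  "smooth_manifold A \<longleftrightarrow> (\<forall>c\<in>A. is_chart c) \<and> (\<Union>c\<in>A. fst c) = UNIV \<and>
     (\<forall>c\<in>A. \<forall>d\<in>A. smooth_compatible c d)"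

definition smooth_fun :: "('m, 'e::euclidean_space) chart set \<Rightarrow> ('m \<Rightarrow> real) \<Rightarrow> bool" where
  "smooth_fun A f \<longleftrightarrow> (\<forall>(U, \<psi>)\<in>A. smooth_on (\<psi> ` U) (f \<circ> inv_into U \<psi>))"


section \<open>Tangent vectors and tensor fields\<close>

type_synonym 'm tvec = "('m \<Rightarrow> real) \<Rightarrow> real"
type_synonym 'm vfield = "'m \<Rightarrow> 'm tvec"

text \<open>Tangent vectors at \<open>p\<close> are the derivations at \<open>p\<close> of the algebra of smooth functions.
  They are extended by \<open>0\<close> to functions that are not smooth, so that equality of tangent vectors
  is equality of derivations.\<close>

definition tangent_space :: "('m, 'e::euclidean_space) chart set \<Rightarrow> 'm \<Rightarrow> 'm tvec set" where
  "tangent_space A p = {v.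
     (\<forall>f h. smooth_fun A f \<longrightarrow> smooth_fun A h \<longrightarrow> v (f + h) = v f + v h) \<and>
     (\<forall>c f. smooth_fun A f \<longrightarrow> v (c *\<^sub>R f) = c * v f) \<and>
     (\<forall>f h. smooth_fun A f \<longrightarrow> smooth_fun A h \<longrightarrow> v (f * h) = f p * v h + h p * v f) \<and>
     (\<forall>f. \<not> smooth_fun A f \<longrightarrow> v f = 0)}"

text \<open>The derivative \<open>X f\<close> of a function along a vector field.\<close>

definition along :: "'m vfield \<Rightarrow> ('m \<Rightarrow> real) \<Rightarrow> 'm \<Rightarrow> real" where
  "along X f = (\<lambda>p. X p f)"

definition vector_field :: "('m, 'e::euclidean_space) chart set \<Rightarrow> 'm vfield \<Rightarrow> bool" where
  "vector_field A X \<longleftrightarrow> (\<forall>p. X p \<in> tangent_space A p) \<and>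
     (\<forall>f. smooth_fun A f \<longrightarrow> smooth_fun A (along X f))"

definition fun_scale :: "('m \<Rightarrow> real) \<Rightarrow> 'm vfield \<Rightarrow> 'm vfield" where
  "fun_scale f X = (\<lambda>p. f p *\<^sub>R X p)"

definition lie_bracket :: "'m vfield \<Rightarrow> 'm vfield \<Rightarrow> 'm vfield" where
  "lie_bracket X Y = (\<lambda>p f. X p (along Y f) - Y p (along X f))"

text \<open>Smooth endomorphisms of the tangent bundle, smooth 1-forms and metrics are families of
  (bi)linear maps on the tangent spaces; smoothness is tested on smooth vector fields.\<close>

definition apply_endo :: "('m \<Rightarrow> 'm tvec \<Rightarrow> 'm tvec) \<Rightarrow> 'm vfield \<Rightarrow> 'm vfield" where
  "apply_endo \<phi> X = (\<lambda>p. \<phi> p (X p))"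

definition tangent_endomorphism ::
  "('m, 'e::euclidean_space) chart set \<Rightarrow> ('m \<Rightarrow> 'm tvec \<Rightarrow> 'm tvec) \<Rightarrow> bool" where
  "tangent_endomorphism A \<phi> \<longleftrightarrow>
     (\<forall>p. \<forall>v\<in>tangent_space A p. \<phi> p v \<in> tangent_space A p) \<and>
     (\<forall>p. \<forall>v\<in>tangent_space A p. \<forall>w\<in>tangent_space A p. \<phi> p (v + w) = \<phi> p v + \<phi> p w) \<and>
     (\<forall>p c. \<forall>v\<in>tangent_space A p. \<phi> p (c *\<^sub>R v) = c *\<^sub>R \<phi> p v) \<and>
     (\<forall>X. vector_field A X \<longrightarrow> vector_field A (apply_endo \<phi> X))"

definition one_form ::
  "('m, 'e::euclidean_space) chart set \<Rightarrow> ('m \<Rightarrow> 'm tvec \<Rightarrow> real) \<Rightarrow> bool" where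
  "one_form A \<eta> \<longleftrightarrow>
     (\<forall>p. \<forall>v\<in>tangent_space A p. \<forall>w\<in>tangent_space A p. \<eta> p (v + w) = \<eta> p v + \<eta> p w) \<and>
     (\<forall>p c. \<forall>v\<in>tangent_space A p. \<eta> p (c *\<^sub>R v) = c * \<eta> p v) \<and>
     (\<forall>X. vector_field A X \<longrightarrow> smooth_fun A (\<lambda>p. \<eta> p (X p)))"

definition pseudo_riemannian_metric ::
  "('m, 'e::euclidean_space) chart set \<Rightarrow> ('m \<Rightarrow> 'm tvec \<Rightarrow> 'm tvec \<Rightarrow> real) \<Rightarrow> bool" where
  "pseudo_riemannian_metric A g \<longleftrightarrow>
     (\<forall>p. \<forall>u\<in>tangent_space A p. \<forall>v\<in>tangent_space A p. \<forall>w\<in>tangent_space A p.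
        g p (u + v) w = g p u w + g p v w) \<and>
     (\<forall>p c. \<forall>v\<in>tangent_space A p. \<forall>w\<in>tangent_space A p. g p (c *\<^sub>R v) w = c * g p v w) \<and>
     (\<forall>p. \<forall>v\<in>tangent_space A p. \<forall>w\<in>tangent_space A p. g p v w = g p w v) \<and>
     (\<forall>p. \<forall>v\<in>tangent_space A p. (\<forall>w\<in>tangent_space A p. g p v w = 0) \<longrightarrow> v = 0) \<and>
     (\<forall>X Y. vector_field A X \<longrightarrow> vector_field A Y \<longrightarrow> smooth_fun A (\<lambda>p. g p (X p) (Y p)))"


section \<open>Levi-Civita connection and curvature\<close>

text \<open>The values of a connection on arguments that are not smooth vector fields are irrelevant
  and left unconstrained.\<close>

definition affine_connection ::
  "('m, 'e::euclidean_space) chart set \<Rightarrow> ('m vfield \<Rightarrow> 'm vfield \<Rightarrow> 'm vfield) \<Rightarrow> bool" where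
  "affine_connection A nabla \<longleftrightarrow>
     (\<forall>X Y. vector_field A X \<longrightarrow> vector_field A Y \<longrightarrow> vector_field A (nabla X Y)) \<and>
     (\<forall>X Y Z. vector_field A X \<longrightarrow> vector_field A Y \<longrightarrow> vector_field A Z \<longrightarrow>
        nabla (X + Y) Z = nabla X Z + nabla Y Z \<and> nabla X (Y + Z) = nabla X Y + nabla X Z) \<and>
     (\<forall>f X Y. smooth_fun A f \<longrightarrow> vector_field A X \<longrightarrow> vector_field A Y \<longrightarrow>
        nabla (fun_scale f X) Y = fun_scale f (nabla X Y) \<and>
        nabla X (fun_scale f Y) = fun_scale (along X f) Y + fun_scale f (nabla X Y))"

definition levi_civita_connection ::
  "('m, 'e::euclidean_space) chart set \<Rightarrow> ('m \<Rightarrow> 'm tvec \<Rightarrow> 'm tvec \<Rightarrow> real) \<Rightarrow>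
   ('m vfield \<Rightarrow> 'm vfield \<Rightarrow> 'm vfield) \<Rightarrow> bool" where
  "levi_civita_connection A g nabla \<longleftrightarrow>
     affine_connection A nabla \<and>
     (\<forall>X Y. vector_field A X \<longrightarrow> vector_field A Y \<longrightarrow> nabla X Y - nabla Y X = lie_bracket X Y) \<and>
     (\<forall>X Y Z p. vector_field A X \<longrightarrow> vector_field A Y \<longrightarrow> vector_field A Z \<longrightarrow>
        along X (\<lambda>q. g q (Y q) (Z q)) p = g p (nabla X Y p) (Z p) + g p (Y p) (nabla X Z p))"

definition curvature ::
  "('m vfield \<Rightarrow> 'm vfield \<Rightarrow> 'm vfield) \<Rightarrow> 'm vfield \<Rightarrow> 'm vfield \<Rightarrow> 'm vfield \<Rightarrow> 'm vfield" where
  "curvature nabla X Y Z = nabla X (nabla Y Z) - nabla Y (nabla X Z) - nabla (lie_bracket X Y) Z"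

definition flat ::
  "('m, 'e::euclidean_space) chart set \<Rightarrow> ('m vfield \<Rightarrow> 'm vfield \<Rightarrow> 'm vfield) \<Rightarrow> bool" where
  "flat A nabla \<longleftrightarrow> (\<forall>X Y Z. vector_field A X \<longrightarrow> vector_field A Y \<longrightarrow> vector_field A Z \<longrightarrow>
     curvature nabla X Y Z = 0)"


section \<open>Almost contact HN-metric 3-structures\<close>

definition kronecker :: "nat \<Rightarrow> nat \<Rightarrow> real" where
  "kronecker \<alpha> \<beta> = (if \<alpha> = \<beta> then 1 else 0)"

definition levi_civita_symbol :: "nat \<Rightarrow> nat \<Rightarrow> nat \<Rightarrow> real" where
  "levi_civita_symbol \<alpha> \<beta> \<gamma> =
     (if (\<alpha>, \<beta>, \<gamma>) \<in> {(1,2,3), (2,3,1), (3,1,2)} then 1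
      else if (\<alpha>, \<beta>, \<gamma>) \<in> {(1,3,2), (3,2,1), (2,1,3)} then -1 else 0)"

text \<open>Families indexed by \<open>\<alpha>\<close> are only relevant for \<open>\<alpha> \<in> {1, 2, 3}\<close>.\<close>

definition almost_contact_3_structure ::
  "('m, 'e::euclidean_space) chart set \<Rightarrow> (nat \<Rightarrow> 'm \<Rightarrow> 'm tvec \<Rightarrow> 'm tvec) \<Rightarrow>
   (nat \<Rightarrow> 'm vfield) \<Rightarrow> (nat \<Rightarrow> 'm \<Rightarrow> 'm tvec \<Rightarrow> real) \<Rightarrow> bool" where
  "almost_contact_3_structure A \<phi> \<xi> \<eta> \<longleftrightarrow>
     (\<forall>\<alpha>\<in>{1,2,3}. tangent_endomorphism A (\<phi> \<alpha>) \<and> vector_field A (\<xi> \<alpha>) \<and> one_form A (\<eta> \<alpha>)) \<and>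
     (\<forall>\<alpha>\<in>{1,2,3}. \<forall>\<beta>\<in>{1,2,3}. \<forall>p.
        (\<forall>v\<in>tangent_space A p.
           \<phi> \<alpha> p (\<phi> \<beta> p v) = - (kronecker \<alpha> \<beta> *\<^sub>R v) + \<eta> \<beta> p v *\<^sub>R \<xi> \<alpha> p
             + (\<Sum>\<gamma>\<in>{1,2,3}. levi_civita_symbol \<alpha> \<beta> \<gamma> *\<^sub>R \<phi> \<gamma> p v)) \<and>
        \<phi> \<alpha> p (\<xi> \<beta> p) = (\<Sum>\<gamma>\<in>{1,2,3}. levi_civita_symbol \<alpha> \<beta> \<gamma> *\<^sub>R \<xi> \<gamma> p) \<and>
        (\<forall>v\<in>tangent_space A p.
           \<eta> \<alpha> p (\<phi> \<beta> p v) = (\<Sum>\<gamma>\<in>{1,2,3}. levi_civita_symbol \<alpha> \<beta> \<gamma> * \<eta> \<gamma> p v)) \<and>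
        \<eta> \<alpha> p (\<xi> \<beta> p) = kronecker \<alpha> \<beta>)"

text \<open>The signs \<open>(1, -1, -1)\<close> of an HN-metric.\<close>

definition hn_sign :: "nat \<Rightarrow> real" where
  "hn_sign \<alpha> = (if \<alpha> = 1 then 1 else -1)"

definition hn_metric ::
  "('m, 'e::euclidean_space) chart set \<Rightarrow> (nat \<Rightarrow> 'm \<Rightarrow> 'm tvec \<Rightarrow> 'm tvec) \<Rightarrow>
   (nat \<Rightarrow> 'm \<Rightarrow> 'm tvec \<Rightarrow> real) \<Rightarrow> ('m \<Rightarrow> 'm tvec \<Rightarrow> 'm tvec \<Rightarrow> real) \<Rightarrow> bool" where
  "hn_metric A \<phi> \<eta> g \<longleftrightarrow>
     pseudo_riemannian_metric A g \<and>
     (\<forall>\<alpha>\<in>{1,2,3}. \<forall>X Y p. vector_field A X \<longrightarrow> vector_field A Y \<longrightarrow>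
        g p (\<phi> \<alpha> p (X p)) (\<phi> \<alpha> p (Y p))
          = hn_sign \<alpha> * g p (X p) (Y p) + \<eta> \<alpha> p (X p) * \<eta> \<alpha> p (Y p))"

definition almost_contact_hn_metric_3_structure ::
  "('m, 'e::euclidean_space) chart set \<Rightarrow> (nat \<Rightarrow> 'm \<Rightarrow> 'm tvec \<Rightarrow> 'm tvec) \<Rightarrow>
   (nat \<Rightarrow> 'm vfield) \<Rightarrow> (nat \<Rightarrow> 'm \<Rightarrow> 'm tvec \<Rightarrow> real) \<Rightarrow>
   ('m \<Rightarrow> 'm tvec \<Rightarrow> 'm tvec \<Rightarrow> real) \<Rightarrow> bool" where
  "almost_contact_hn_metric_3_structure A \<phi> \<xi> \<eta> g \<longleftrightarrow>
     almost_contact_3_structure A \<phi> \<xi> \<eta> \<and> hn_metric A \<phi> \<eta> g"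

definition cov_deriv_endo ::
  "('m vfield \<Rightarrow> 'm vfield \<Rightarrow> 'm vfield) \<Rightarrow> ('m \<Rightarrow> 'm tvec \<Rightarrow> 'm tvec) \<Rightarrow>
   'm vfield \<Rightarrow> 'm vfield \<Rightarrow> 'm vfield" where
  "cov_deriv_endo nabla \<phi> X Y = nabla X (apply_endo \<phi> Y) - apply_endo \<phi> (nabla X Y)"

definition fundamental_tensor ::
  "('m \<Rightarrow> 'm tvec \<Rightarrow> 'm tvec \<Rightarrow> real) \<Rightarrow> ('m vfield \<Rightarrow> 'm vfield \<Rightarrow> 'm vfield) \<Rightarrow>
   ('m \<Rightarrow> 'm tvec \<Rightarrow> 'm tvec) \<Rightarrow> 'm vfield \<Rightarrow> 'm vfield \<Rightarrow> 'm vfield \<Rightarrow> 'm \<Rightarrow> real" where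
  "fundamental_tensor g nabla \<phi> X Y Z = (\<lambda>p. g p (cov_deriv_endo nabla \<phi> X Y p) (Z p))"

text \<open>The connection is a parameter, to be instantiated with the Levi-Civita connection of \<open>g\<close>.\<close>

definition cosymplectic_hn_metric_3_structure ::
  "('m, 'e::euclidean_space) chart set \<Rightarrow> (nat \<Rightarrow> 'm \<Rightarrow> 'm tvec \<Rightarrow> 'm tvec) \<Rightarrow>
   (nat \<Rightarrow> 'm vfield) \<Rightarrow> (nat \<Rightarrow> 'm \<Rightarrow> 'm tvec \<Rightarrow> real) \<Rightarrow>
   ('m \<Rightarrow> 'm tvec \<Rightarrow> 'm tvec \<Rightarrow> real) \<Rightarrow> ('m vfield \<Rightarrow> 'm vfield \<Rightarrow> 'm vfield) \<Rightarrow> bool" where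
  "cosymplectic_hn_metric_3_structure A \<phi> \<xi> \<eta> g nabla \<longleftrightarrow>
     almost_contact_hn_metric_3_structure A \<phi> \<xi> \<eta> g \<and>
     (\<forall>\<alpha>\<in>{1,2,3}. \<forall>X Y Z p. vector_field A X \<longrightarrow> vector_field A Y \<longrightarrow> vector_field A Z \<longrightarrow>
        fundamental_tensor g nabla (\<phi> \<alpha>) X Y Z p = 0)"

end

theory Submission
  imports Defs
begin

text \<open>Let \<open>R\<close> be the curvature of the Levi-Civita connection.  The tensors \<open>F\<^sub>\<alpha>\<close> vanish exactly when the
three endomorphisms \<open>\<phi>\<^sub>\<alpha>\<close> are parallel, so that \<open>R(x,y)\<close> commutes with each of them.  The metric
condition says that \<open>\<phi>\<^sub>1\<close> is skew and that \<open>\<phi>\<^sub>2\<close>, \<open>\<phi>\<^sub>3\<close> are symmetric with respect to \<open>g\<close>.  These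
facts contradict each other unless \<open>R = 0\<close>:

  \<^item> A \<open>g\<close>-symmetric endomorphism \<open>J\<close> that commutes with all \<open>R(x,y)\<close> satisfies
    \<open>R(Jx,y)z = J(R(x,y)z)\<close> (lemma \<open>commuting_symmetric_pure\<close>, from pair symmetry and the first
    Bianchi identity).  This applies to \<open>\<phi>\<^sub>2\<close> and \<open>\<phi>\<^sub>3\<close>, hence to their composition, and, as
    \<open>\<phi>\<^sub>2 \<circ> \<phi>\<^sub>3 = \<phi>\<^sub>1 + \<xi>\<^sub>2 \<otimes> \<eta>\<^sub>3\<close>, also to \<open>\<phi>\<^sub>1\<close>.
  \<^item> For the skew endomorphism \<open>\<phi>\<^sub>1\<close> the same use of pair symmetry gives
    \<open>R(\<phi>\<^sub>1x,y) = - R(x,\<phi>\<^sub>1y)\<close>, and the two rules together force \<open>\<phi>\<^sub>1(R(x,y)z) = - \<phi>\<^sub>1(R(x,y)z) = 0\<close>.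
    As \<open>\<phi>\<^sub>1\<close> squares to \<open>-1\<close> on the image of \<open>R(x,y)\<close>, that image is zero (lemma
    \<open>quaternionic_curvature_vanishes\<close>).

The terms with Reeb fields disappear because the image of \<open>R(x,y)\<close> is annihilated by every
\<open>\<eta>\<^sub>\<alpha>\<close>.  Indeed, \<open>\<eta>\<^sub>\<alpha>\<close> is up to sign the metric dual of \<open>\<xi>\<^sub>\<alpha>\<close>, and \<open>R(x,y)\<xi>\<^sub>\<alpha> = 0\<close>:  applying \<open>\<phi>\<^sub>\<alpha>\<close> to
this vector gives \<open>R(x,y)(\<phi>\<^sub>\<alpha>\<xi>\<^sub>\<alpha>) = 0\<close>, so it is a multiple of \<open>\<xi>\<^sub>\<alpha>\<close>, and it is orthogonal to \<open>\<xi>\<^sub>\<alpha>\<close>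
because \<open>R(x,y)\<close> is skew.

All of this algebra takes place in the space of global vector fields, where \<open>g\<close> takes values in
functions.  It uses that a vector field orthogonal to all vector fields is zero, whereas the
definition of a metric provides nondegeneracy on each tangent space.  The bridge is lemma
\<open>tangent_vector_extends\<close>: every derivation at a point is the value of a smooth vector field.  Its
proof is where the smooth structure enters, through bump functions and Hadamard's lemma, which
together express a derivation at \<open>p\<close> by the partial derivatives at \<open>p\<close> in a chart.\<close>

section \<open>Functions with continuous partial derivatives\<close>

lemma Ck_on_cong:
  assumes "open S" "\<And>x. x \<in> S \<Longrightarrow> f x = g x"
  shows "Ck_on k S f \<longleftrightarrow> Ck_on k S g"
  using assms(2)
proof (induction k arbitrary: f g)
  case 0
  then show ?case by (simp cong: continuous_on_cong)
next
  case (Suc k)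
  have der: "(f has_derivative D) (at x) \<longleftrightarrow> (g has_derivative D) (at x)" if "x \<in> S" for x D
    using has_derivative_transform_within_open[OF _ assms(1) that, of f D UNIV g]
      has_derivative_transform_within_open[OF _ assms(1) that, of g D UNIV f] Suc.prems by auto
  have fd: "frechet_derivative f (at x) = frechet_derivative g (at x)" if "x \<in> S" for x
    using der[OF that] by (simp add: frechet_derivative_def)
  have d: "f differentiable (at x) \<longleftrightarrow> g differentiable (at x)" if "x \<in> S" for x
    using der[OF that] by (simp add: differentiable_def)
  have "Ck_on k S (\<lambda>x. frechet_derivative f (at x) i) \<longleftrightarrow>
        Ck_on k S (\<lambda>x. frechet_derivative g (at x) i)" for i
    by (rule Suc.IH) (simp add: fd)
  then show ?case using d by simp
qed

lemma Ck_on_SucI: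
  assumes "open S" "\<And>x. x \<in> S \<Longrightarrow> (f has_derivative f' x) (at x)"
    and "\<And>i. i \<in> Basis \<Longrightarrow> Ck_on k S (\<lambda>x. f' x i)"
  shows "Ck_on (Suc k) S f"
proof -
  have "frechet_derivative f (at x) = f' x" if "x \<in> S" for x
    using frechet_derivative_at[OF assms(2)[OF that]] by simp
  then have "Ck_on k S (\<lambda>x. frechet_derivative f (at x) i)" if "i \<in> Basis" for i
    using assms(3)[OF that] Ck_on_cong[OF assms(1), of "\<lambda>x. frechet_derivative f (at x) i" "\<lambda>x. f' x i" k] by simp
  then show ?thesis using assms(2) by (auto simp: differentiable_def)
qed

lemma Ck_on_SucE:
  assumes "Ck_on (Suc k) S f"
  obtains f' where "\<And>x. x \<in> S \<Longrightarrow> (f has_derivative f' x) (at x)"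
    and "\<And>i. i \<in> Basis \<Longrightarrow> Ck_on k S (\<lambda>x. f' x i)"
  using that[of "\<lambda>x. frechet_derivative f (at x)"] assms
  by (auto simp: frechet_derivative_works)

lemma Ck_on_Suc_imp: "Ck_on (Suc k) S f \<Longrightarrow> Ck_on k S f"
proof (induction k arbitrary: f)
  case 0
  then show ?case
    by (auto intro: differentiable_imp_continuous_within continuous_at_imp_continuous_on)
next
  case (Suc k)
  have "Ck_on k S (\<lambda>x. frechet_derivative f (at x) i)" if "i \<in> Basis" for i
    using Suc.prems that by (intro Suc.IH) simp
  then show ?case using Suc.prems by auto
qed

lemma Ck_on_imp_continuous_on: "Ck_on k S f \<Longrightarrow> continuous_on S f"
proof (induction k)
  case (Suc k)
  then show ?case using Ck_on_Suc_imp by blast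
qed simp

lemma Ck_on_subset: "Ck_on k S f \<Longrightarrow> T \<subseteq> S \<Longrightarrow> Ck_on k T f"
  by (induction k arbitrary: f) (auto intro: continuous_on_subset)

lemma Ck_on_local:
  assumes "\<And>x. x \<in> S \<Longrightarrow> \<exists>T. open T \<and> x \<in> T \<and> Ck_on k T f"
  shows "Ck_on k S f"
  using assms
proof (induction k arbitrary: f)
  case 0
  then show ?case
    by (force simp: continuous_on_eq_continuous_at intro!: continuous_at_imp_continuous_on)
next
  case (Suc k)
  then have "f differentiable (at x)" if "x \<in> S" for x using that by fastforce
  moreover have "Ck_on k S (\<lambda>x. frechet_derivative f (at x) i)" if "i \<in> Basis" for i
    using Suc.prems that by (intro Suc.IH) fastforce
  ultimately show ?case by auto
qed

lemma Ck_on_const: "open S \<Longrightarrow> Ck_on k S (\<lambda>x. c)"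
proof (induction k arbitrary: c)
  case (Suc k)
  show ?case
    by (rule Ck_on_SucI[where f' = "\<lambda>x h. 0"]) (auto intro: Suc)
qed simp

lemma Ck_on_linear:
  assumes "open S" "bounded_linear L" "Ck_on k S f"
  shows "Ck_on k S (\<lambda>x. L (f x))"
  using assms(3)
proof (induction k arbitrary: f)
  case 0
  then show ?case using bounded_linear.continuous_on[OF assms(2)] by simp
next
  case (Suc k)
  from Ck_on_SucE[OF Suc.prems] obtain f' where
    f': "\<And>x. x \<in> S \<Longrightarrow> (f has_derivative f' x) (at x)" "\<And>i. i \<in> Basis \<Longrightarrow> Ck_on k S (\<lambda>x. f' x i)"
    by blast
  show ?case
    by (rule Ck_on_SucI[OF assms(1), where f' = "\<lambda>x h. L (f' x h)"])
      (auto intro: Suc.IH f' bounded_linear.has_derivative[OF assms(2)])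
qed

lemma Ck_on_add:
  assumes "open S" "Ck_on k S f" "Ck_on k S g"
  shows "Ck_on k S (\<lambda>x. f x + g x)"
  using assms(2,3)
proof (induction k arbitrary: f g)
  case 0
  then show ?case by (simp add: continuous_on_add)
next
  case (Suc k)
  from Ck_on_SucE[OF Suc.prems(1)] obtain f' where
    f': "\<And>x. x \<in> S \<Longrightarrow> (f has_derivative f' x) (at x)" "\<And>i. i \<in> Basis \<Longrightarrow> Ck_on k S (\<lambda>x. f' x i)"
    by blast
  from Ck_on_SucE[OF Suc.prems(2)] obtain g' where
    g': "\<And>x. x \<in> S \<Longrightarrow> (g has_derivative g' x) (at x)" "\<And>i. i \<in> Basis \<Longrightarrow> Ck_on k S (\<lambda>x. g' x i)"
    by blast
  show ?case
    by (rule Ck_on_SucI[OF assms(1), where f' = "\<lambda>x h. f' x h + g' x h"])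
      (auto intro: Suc.IH f' g' has_derivative_add)
qed

lemma Ck_on_sum:
  assumes "open S" "finite I" "\<And>i. i \<in> I \<Longrightarrow> Ck_on k S (f i)"
  shows "Ck_on k S (\<lambda>x. \<Sum>i\<in>I. f i x)"
  using assms(2,3)
  by (induction I) (auto intro: Ck_on_const Ck_on_add assms(1))

lemma Ck_on_bilinear:
  assumes "open S" "bounded_bilinear B" "Ck_on k S f" "Ck_on k S g"
  shows "Ck_on k S (\<lambda>x. B (f x) (g x))"
  using assms(3,4)
proof (induction k arbitrary: f g)
  case 0
  then show ?case using bounded_bilinear.continuous_on[OF assms(2)] by simp
next
  case (Suc k)
  from Ck_on_SucE[OF Suc.prems(1)] obtain f' where
    f': "\<And>x. x \<in> S \<Longrightarrow> (f has_derivative f' x) (at x)" "\<And>i. i \<in> Basis \<Longrightarrow> Ck_on k S (\<lambda>x. f' x i)"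
    by blast
  from Ck_on_SucE[OF Suc.prems(2)] obtain g' where
    g': "\<And>x. x \<in> S \<Longrightarrow> (g has_derivative g' x) (at x)" "\<And>i. i \<in> Basis \<Longrightarrow> Ck_on k S (\<lambda>x. g' x i)"
    by blast
  note lower = Suc.prems[THEN Ck_on_Suc_imp]
  show ?case
    by (rule Ck_on_SucI[OF assms(1), where f' = "\<lambda>x h. B (f x) (g' x h) + B (f' x h) (g x)"])
      (auto intro!: Ck_on_add assms(1) Suc.IH f' g' lower bounded_bilinear.FDERIV[OF assms(2)])
qed

lemma linear_basis_expansion:
  fixes L :: "'e::euclidean_space \<Rightarrow> 'b::real_vector"
  assumes "linear L"
  shows "L v = (\<Sum>b\<in>Basis. (v \<bullet> b) *\<^sub>R L b)"
proof -
  have "L (\<Sum>b\<in>Basis. (v \<bullet> b) *\<^sub>R b) = (\<Sum>b\<in>Basis. (v \<bullet> b) *\<^sub>R L b)"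
    using assms by (simp only: linear_sum linear_scale)
  then show ?thesis by (simp only: euclidean_representation)
qed

text \<open>By the chain rule the partial derivatives of \<open>f \<circ> h\<close> are sums of products of a component of a
partial derivative of \<open>h\<close> with a partial derivative of \<open>f\<close> composed with \<open>h\<close>; both factors are of
class \<open>C\<^sup>k\<close> by induction.\<close>

lemma Ck_on_compose:
  fixes f :: "'f::euclidean_space \<Rightarrow> 'b::real_normed_vector" and h :: "'e::euclidean_space \<Rightarrow> 'f"
  assumes "open S" "open T" "h ` S \<subseteq> T" "Ck_on k T f" "Ck_on k S h"
  shows "Ck_on k S (\<lambda>x. f (h x))"
  using assms(4,5)
proof (induction k arbitrary: f)
  case 0
  then show ?case using continuous_on_compose2[of T f S h] assms(3) by simp
next
  case (Suc k)
  from Ck_on_SucE[OF Suc.prems(1)] obtain f' where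
    f': "\<And>x. x \<in> T \<Longrightarrow> (f has_derivative f' x) (at x)" "\<And>i. i \<in> Basis \<Longrightarrow> Ck_on k T (\<lambda>x. f' x i)"
    by blast
  from Ck_on_SucE[OF Suc.prems(2)] obtain h' where
    h': "\<And>x. x \<in> S \<Longrightarrow> (h has_derivative h' x) (at x)" "\<And>i. i \<in> Basis \<Longrightarrow> Ck_on k S (\<lambda>x. h' x i)"
    by blast
  let ?D = "\<lambda>x v. \<Sum>b\<in>Basis. (h' x v \<bullet> b) *\<^sub>R f' (h x) b"
  have chain: "((\<lambda>x. f (h x)) has_derivative ?D x) (at x)" if "x \<in> S" for x
  proof -
    have hx: "h x \<in> T" using that assms(3) by auto
    have "linear (f' (h x))" using f'(1)[OF hx] has_derivative_linear by blast
    then have "f' (h x) \<circ> h' x = ?D x"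
      by (intro ext) (simp only: o_def linear_basis_expansion[of _ "h' x _"])
    then show ?thesis
      using diff_chain_at[OF h'(1)[OF that] f'(1)[OF hx]] by (simp add: o_def)
  qed
  show ?case
  proof (rule Ck_on_SucI[OF assms(1) chain])
    fix i :: 'e assume i: "i \<in> Basis"
    show "Ck_on k S (\<lambda>x. ?D x i)"
      by (intro Ck_on_sum Ck_on_bilinear[OF assms(1) bounded_bilinear_scaleR]
          Ck_on_linear[OF assms(1) bounded_linear_inner_left] h'(2)[OF i] Suc.IH f'(2)
          Ck_on_Suc_imp[OF Suc.prems(2)] assms(1) finite_Basis)
  qed
qed

lemma smooth_on_subset: "smooth_on S f \<Longrightarrow> T \<subseteq> S \<Longrightarrow> smooth_on T f"
  unfolding smooth_on_def using Ck_on_subset by blast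

lemma smooth_on_cong:
  "open S \<Longrightarrow> (\<And>x. x \<in> S \<Longrightarrow> f x = g x) \<Longrightarrow> smooth_on S f \<longleftrightarrow> smooth_on S g"
  unfolding smooth_on_def using Ck_on_cong by blast

lemma smooth_on_const: "open S \<Longrightarrow> smooth_on S (\<lambda>x. c)"
  unfolding smooth_on_def by (simp add: Ck_on_const)

lemma smooth_on_linear:
  assumes "open S" "bounded_linear L"
  shows "smooth_on S L"
  unfolding smooth_on_def
proof
  fix k
  show "Ck_on k S L"
  proof (cases k)
    case 0
    then show ?thesis using assms(2) by (simp add: linear_continuous_on)
  next
    case (Suc j)
    show ?thesis unfolding Suc
      by (rule Ck_on_SucI[where f' = "\<lambda>x. L"])
        (auto intro: assms Ck_on_const bounded_linear_imp_has_derivative)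
  qed
qed

lemma smooth_on_id: "open S \<Longrightarrow> smooth_on S (\<lambda>x. x)"
  by (rule smooth_on_linear[OF _ bounded_linear_ident])

lemma smooth_on_add:
  "open S \<Longrightarrow> smooth_on S f \<Longrightarrow> smooth_on S g \<Longrightarrow> smooth_on S (\<lambda>x. f x + g x)"
  unfolding smooth_on_def by (simp add: Ck_on_add)

lemma smooth_on_sum:
  "open S \<Longrightarrow> finite I \<Longrightarrow> (\<And>i. i \<in> I \<Longrightarrow> smooth_on S (f i)) \<Longrightarrow> smooth_on S (\<lambda>x. \<Sum>i\<in>I. f i x)"
  unfolding smooth_on_def by (simp add: Ck_on_sum)

lemma smooth_on_bilinear:
  "open S \<Longrightarrow> bounded_bilinear B \<Longrightarrow> smooth_on S f \<Longrightarrow> smooth_on S g \<Longrightarrow>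
    smooth_on S (\<lambda>x. B (f x) (g x))"
  unfolding smooth_on_def by (simp add: Ck_on_bilinear)

lemmas smooth_on_mult = smooth_on_bilinear[OF _ bounded_bilinear_mult]

lemma smooth_on_compose:
  "open S \<Longrightarrow> open T \<Longrightarrow> h ` S \<subseteq> T \<Longrightarrow> smooth_on T f \<Longrightarrow> smooth_on S h \<Longrightarrow>
    smooth_on S (\<lambda>x. f (h x))"
  unfolding smooth_on_def by (blast intro: Ck_on_compose)

lemma smooth_on_local:
  "(\<And>x. x \<in> S \<Longrightarrow> \<exists>T. open T \<and> x \<in> T \<and> smooth_on T f) \<Longrightarrow> smooth_on S f"
proof -
  assume loc: "\<And>x. x \<in> S \<Longrightarrow> \<exists>T. open T \<and> x \<in> T \<and> smooth_on T f"
  have "Ck_on k S f" for k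
    by (rule Ck_on_local) (use loc in \<open>auto simp: smooth_on_def\<close>)
  then show ?thesis by (simp add: smooth_on_def)
qed

lemma smooth_on_derivative:
  assumes "smooth_on S f"
  shows "x \<in> S \<Longrightarrow> (f has_derivative frechet_derivative f (at x)) (at x)"
    and "i \<in> Basis \<Longrightarrow> smooth_on S (\<lambda>x. frechet_derivative f (at x) i)"
proof -
  have Suc: "Ck_on (Suc k) S f" for k using assms unfolding smooth_on_def by (rule spec)
  show "(f has_derivative frechet_derivative f (at x)) (at x)" if "x \<in> S"
    using Suc[of 0] that frechet_derivative_works[of f "at x"] by simp
  show "smooth_on S (\<lambda>x. frechet_derivative f (at x) i)" if "i \<in> Basis"
    unfolding smooth_on_def using Suc that by simp
qed

section \<open>Bump functions\<close>

text \<open>The classical flat function \<open>exp (-1/x)\<close>, divided by powers of \<open>x\<close>:  this family is closed under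
differentiation up to linear combinations, which makes smoothness a plain induction.\<close>

definition flat_exp :: "nat \<Rightarrow> real \<Rightarrow> real" where
  "flat_exp m x = (if x > 0 then exp (- 1 / x) / x ^ m else 0)"

text \<open>Substituting \<open>1/x\<close>, this is the fact that exponentials outgrow powers.\<close>

lemma flat_exp_tendsto_0: "(flat_exp m \<longlongrightarrow> 0) (at 0)"
proof -
  have "((\<lambda>x. x ^ m / exp x) \<longlongrightarrow> 0) (at_top :: real filter)"
    by (rule tendsto_power_div_exp_0)
  then have "((\<lambda>x. inverse x ^ m / exp (inverse x)) \<longlongrightarrow> (0::real)) (at_right 0)"
    by (rule filterlim_compose[OF _ filterlim_inverse_at_top_right])
  moreover have "\<forall>\<^sub>F x in at_right 0. inverse x ^ m / exp (inverse x) = flat_exp m x"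
    by (auto simp: eventually_at_filter flat_exp_def field_simps exp_minus)
  ultimately have "(flat_exp m \<longlongrightarrow> 0) (at_right 0)"
    using tendsto_cong by fast
  moreover have "\<forall>\<^sub>F x in at_left 0. flat_exp m x = 0"
    by (auto simp: eventually_at_filter flat_exp_def)
  then have "(flat_exp m \<longlongrightarrow> 0) (at_left 0)"
    by (simp add: tendsto_eventually)
  ultimately show ?thesis by (simp add: filterlim_split_at)
qed

lemma flat_exp_has_derivative:
  "(flat_exp m has_field_derivative flat_exp (m + 2) x - m * flat_exp (m + 1) x) (at x)"
proof -
  consider "x < 0" | "x = 0" | "x > 0" by linarith
  then show ?thesis
  proof cases
    case 1
    have "((\<lambda>x. 0) has_field_derivative 0) (at x)" by simp
    then have "(flat_exp m has_field_derivative 0) (at x)"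
      by (rule has_field_derivative_transform_within_open[where S = "{..<0}"])
        (use 1 in \<open>auto simp: flat_exp_def\<close>)
    then show ?thesis using 1 by (simp add: flat_exp_def)
  next
    case 2
    \<comment> \<open>The difference quotient at 0 of one member of the family is the next member.\<close>
    have "(\<lambda>y. (flat_exp m y - flat_exp m 0) / (y - 0)) = flat_exp (m + 1)"
      by (auto simp: flat_exp_def fun_eq_iff)
    then have "(flat_exp m has_field_derivative 0) (at 0)"
      using flat_exp_tendsto_0[of "m + 1"] by (simp add: has_field_derivative_iff)
    then show ?thesis using 2 by (simp add: flat_exp_def)
  next
    case 3
    have "((\<lambda>x. exp (- 1 / x) / x ^ m) has_field_derivative
        (exp (- 1 / x) * (1 / x\<^sup>2) * x ^ m - exp (- 1 / x) * (m * x ^ (m - 1))) / (x ^ m * x ^ m)) (at x)"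
      using 3 by (auto intro!: derivative_eq_intros simp: power2_eq_square)
    moreover have "(exp (- 1 / x) * (1 / x\<^sup>2) * x ^ m - exp (- 1 / x) * (m * x ^ (m - 1))) / (x ^ m * x ^ m)
        = flat_exp (m + 2) x - m * flat_exp (m + 1) x"
      using 3 by (cases m) (simp_all add: flat_exp_def field_simps power2_eq_square)
    ultimately have "((\<lambda>x. exp (- 1 / x) / x ^ m) has_field_derivative
        flat_exp (m + 2) x - m * flat_exp (m + 1) x) (at x)" by simp
    then show ?thesis
      by (rule has_field_derivative_transform_within_open[where S = "{0<..}"])
        (use 3 in \<open>auto simp: flat_exp_def\<close>)
  qed
qed

lemma smooth_on_flat_exp: "smooth_on UNIV (flat_exp m)"
proof -
  have "Ck_on k UNIV (flat_exp m)" for k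
  proof (induction k arbitrary: m)
    case 0
    have "isCont (flat_exp m) x" for x
      using flat_exp_has_derivative DERIV_isCont by blast
    then show ?case by (simp add: continuous_at_imp_continuous_on)
  next
    case (Suc k)
    show ?case
    proof (rule Ck_on_SucI)
      show "(flat_exp m has_derivative
          (\<lambda>h. (flat_exp (m + 2) x + (- real m) * flat_exp (m + 1) x) * h)) (at x)" for x
        using flat_exp_has_derivative[of m x] by (simp add: has_field_derivative_def)
      show "Ck_on k UNIV (\<lambda>x. (flat_exp (m + 2) x + (- real m) * flat_exp (m + 1) x) * i)" for i
        by (intro Ck_on_bilinear[OF _ bounded_bilinear_mult] Ck_on_add Ck_on_const Suc.IH open_UNIV)
    qed simp
  qed
  then show ?thesis by (simp add: smooth_on_def)
qed

text \<open>A derivation at \<open>x\<^sub>0\<close> does not see a factor with value 1 at \<open>x\<^sub>0\<close> in front of a function that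
vanishes there, so the value at \<open>x\<^sub>0\<close> and the support are all that localising derivations requires.\<close>

lemma bump_function:
  fixes x0 :: "'e::euclidean_space"
  assumes "s > 0"
  obtains b :: "'e \<Rightarrow> real" where "smooth_on UNIV b" "b x0 = 1" "\<And>x. x \<notin> cball x0 s \<Longrightarrow> b x = 0"
proof
  let ?b = "\<lambda>x. flat_exp 0 (s\<^sup>2 + (-1) * ((x + (-x0)) \<bullet> (x + (-x0)))) * (1 / flat_exp 0 (s\<^sup>2))"
  show "smooth_on UNIV ?b"
    by (intro smooth_on_mult smooth_on_compose[OF _ _ _ smooth_on_flat_exp] smooth_on_const
        smooth_on_add smooth_on_bilinear[OF _ bounded_bilinear_inner] smooth_on_id open_UNIV subset_UNIV)
  show "?b x0 = 1" using assms by (simp add: flat_exp_def)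
  fix x assume "x \<notin> cball x0 s"
  then have "s < norm (x - x0)" by (simp add: dist_norm norm_minus_commute)
  then have "s\<^sup>2 \<le> (norm (x - x0))\<^sup>2" using assms by (intro power_mono) auto
  then show "?b x = 0" by (simp add: flat_exp_def power2_norm_eq_inner)
qed

section \<open>Hadamard's lemma\<close>

lemma segment_in_ball:
  fixes x0 :: "'e::real_normed_vector"
  assumes "x \<in> ball x0 r" "t \<in> {0..1}"
  shows "x0 + t *\<^sub>R (x - x0) \<in> ball x0 r"
proof -
  have "t * norm (x - x0) \<le> norm (x - x0)" using assms(2) by (simp add: mult_left_le_one_le)
  then show ?thesis using assms by (simp add: dist_norm norm_minus_commute)
qed

text \<open>The factors of Hadamard's lemma are integrals of this form with \<open>m = 0\<close>.  Differentiating under the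
integral sign produces another factor \<open>t\<close>, so the induction on \<open>k\<close> has to cover all powers of \<open>t\<close>.\<close>

lemma Ck_on_segment_integral:
  fixes f :: "'e::euclidean_space \<Rightarrow> real"
  assumes "Ck_on k (ball x0 r) f"
  shows "Ck_on k (ball x0 r) (\<lambda>x. integral {0..1} (\<lambda>t. t ^ m * f (x0 + t *\<^sub>R (x - x0))))"
  using assms
proof (induction k arbitrary: f m)
  case 0
  have "continuous_on (ball x0 r \<times> {0..1}) (\<lambda>(x, t). t ^ m * f (x0 + t *\<^sub>R (x - x0)))"
    unfolding split_beta
    by (intro continuous_intros continuous_on_compose2[OF 0[simplified]])
      (use segment_in_ball[of _ x0 r] in \<open>force simp del: mem_ball\<close>)
  then show ?case
    using integral_continuous_on_param[of "ball x0 r" 0 "1::real"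
        "\<lambda>x t. t ^ m * f (x0 + t *\<^sub>R (x - x0))"] by simp
next
  case (Suc k)
  from Ck_on_SucE[OF Suc.prems] obtain f' where
    f': "\<And>x. x \<in> ball x0 r \<Longrightarrow> (f has_derivative f' x) (at x)"
      "\<And>i. i \<in> Basis \<Longrightarrow> Ck_on k (ball x0 r) (\<lambda>x. f' x i)"
    by blast
  note seg = segment_in_ball[of _ x0 r]
  have cf: "continuous_on (ball x0 r) f"
    by (rule Ck_on_imp_continuous_on[OF Suc.prems])
  have cf': "continuous_on (ball x0 r) (\<lambda>x. f' x i)" if "i \<in> Basis" for i
    by (rule Ck_on_imp_continuous_on[OF f'(2)[OF that]])
  let ?g = "\<lambda>x t. t ^ m * f (x0 + t *\<^sub>R (x - x0))"
  let ?h = "\<lambda>i x. integral {0..1} (\<lambda>t. t ^ Suc m * f' (x0 + t *\<^sub>R (x - x0)) i)"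
  \<comment> \<open>The derivative in x of the integrand, written in a basis so that its continuity as
    an operator-valued function reduces to that of the partial derivatives.\<close>
  let ?D = "\<lambda>x t. \<Sum>i\<in>Basis. (t ^ Suc m * f' (x0 + t *\<^sub>R (x - x0)) i) *\<^sub>R blinfun_inner_left i"
  have lin: "f' z v = (\<Sum>i\<in>Basis. f' z i * (v \<bullet> i))" if "z \<in> ball x0 r" for z v
  proof -
    have "linear (f' z)" using f'(1)[OF that] has_derivative_linear by blast
    from linear_basis_expansion[OF this, of v] show ?thesis
      by (simp add: mult.commute)
  qed
  have inner: "((\<lambda>x. ?g x t) has_derivative blinfun_apply (?D x t)) (at x within ball x0 r)"
    if x: "x \<in> ball x0 r" and t: "t \<in> cbox 0 1" for x t
  proof -
    have z: "x0 + t *\<^sub>R (x - x0) \<in> ball x0 r" using seg[OF x] t by simp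
    have "((\<lambda>x. x0 + t *\<^sub>R (x - x0)) has_derivative (\<lambda>v. t *\<^sub>R v)) (at x)"
      by (auto intro!: derivative_eq_intros)
    from diff_chain_at[OF this f'(1)[OF z]]
    have "((\<lambda>x. f (x0 + t *\<^sub>R (x - x0))) has_derivative (\<lambda>v. f' (x0 + t *\<^sub>R (x - x0)) (t *\<^sub>R v))) (at x)"
      by (simp add: o_def)
    from has_derivative_mult_right[OF this, of "t ^ m"]
    have "((\<lambda>x. ?g x t) has_derivative (\<lambda>v. t ^ m * f' (x0 + t *\<^sub>R (x - x0)) (t *\<^sub>R v))) (at x)" .
    moreover have "(\<lambda>v. t ^ m * f' (x0 + t *\<^sub>R (x - x0)) (t *\<^sub>R v)) = blinfun_apply (?D x t)"
      by (auto simp: fun_eq_iff lin[OF z, of "t *\<^sub>R v" for v] blinfun.sum_left blinfun.scaleR_left sum_distrib_left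
          inner_commute intro!: sum.cong)
    ultimately show ?thesis by (simp add: has_derivative_at_withinI)
  qed
  have int: "?g x integrable_on cbox 0 1" if "x \<in> ball x0 r" for x
    by (intro integrable_continuous continuous_intros continuous_on_compose2[OF cf])
      (use seg[OF that] in \<open>auto simp del: mem_ball\<close>)
  have cg': "continuous_on (ball x0 r \<times> {0..1}) (\<lambda>(x, t). t ^ Suc m * f' (x0 + t *\<^sub>R (x - x0)) i)"
    if "i \<in> Basis" for i
    unfolding split_beta
    by (intro continuous_intros continuous_on_compose2[OF cf'[OF that]])
      (use seg in \<open>force simp del: mem_ball\<close>)
  have cD: "continuous_on (ball x0 r \<times> cbox 0 1) (\<lambda>(x, t). ?D x t)"
    using cg' unfolding split_beta
    by (intro continuous_on_sum continuous_on_scaleR continuous_on_const) simp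
  have int': "(\<lambda>t. t ^ Suc m * f' (x0 + t *\<^sub>R (x - x0)) i) integrable_on cbox 0 1"
    if "x \<in> ball x0 r" "i \<in> Basis" for x i
    by (intro integrable_continuous continuous_intros continuous_on_compose2[OF cf'[OF that(2)]])
      (use seg[OF that(1)] in \<open>auto simp del: mem_ball\<close>)
  have der: "((\<lambda>x. integral {0..1} (?g x)) has_derivative (\<lambda>v. \<Sum>i\<in>Basis. ?h i x * (v \<bullet> i))) (at x)"
    if x: "x \<in> ball x0 r" for x
  proof -
    have "integral (cbox 0 1) (?D x) = (\<Sum>i\<in>Basis. integral (cbox 0 1)
        (\<lambda>t. (t ^ Suc m * f' (x0 + t *\<^sub>R (x - x0)) i) *\<^sub>R blinfun_inner_left i))"
      by (intro integral_sum finite_Basis integrable_continuous continuous_intros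
          continuous_on_compose2[OF cf']) (use seg[OF x] in \<open>auto simp del: mem_ball\<close>)
    also have "\<dots> = (\<Sum>i\<in>Basis. ?h i x *\<^sub>R blinfun_inner_left i)"
      using int'[OF x] by (intro sum.cong refl integral_unique)
        (auto intro!: has_integral_scaleR_left integrable_integral)
    finally have D: "blinfun_apply (integral (cbox 0 1) (?D x)) = (\<lambda>v. \<Sum>i\<in>Basis. ?h i x * (v \<bullet> i))"
      by (auto simp: fun_eq_iff blinfun.sum_left blinfun.scaleR_left inner_commute)
    have "((\<lambda>x. integral (cbox 0 1) (?g x)) has_derivative integral (cbox 0 1) (?D x))
        (at x within ball x0 r)"
      by (rule leibniz_rule[OF inner int cD x convex_ball])
    then show ?thesis using x unfolding D by (simp add: at_within_open[OF x])
  qed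
  show ?case
  proof (rule Ck_on_SucI[OF open_ball der])
    fix j :: 'e assume "j \<in> Basis"
    then have "Ck_on k (ball x0 r) (?h j)" by (intro Suc.IH f'(2))
    moreover have "(\<Sum>i\<in>Basis. ?h i x * (j \<bullet> i)) = ?h j x" for x
      using \<open>j \<in> Basis\<close> by (subst sum.remove[of _ j]) (auto simp: inner_Basis split: if_splits intro!: sum.neutral)
    ultimately show "Ck_on k (ball x0 r) (\<lambda>x. \<Sum>i\<in>Basis. ?h i x * (j \<bullet> i))" by simp
  qed
qed

text \<open>Integrate the derivative of \<open>t \<mapsto> f (x\<^sub>0 + t (x - x\<^sub>0))\<close> over the unit interval.\<close>

lemma hadamard:
  fixes f :: "'e::euclidean_space \<Rightarrow> real"
  assumes "smooth_on (ball x0 r) f" "r > 0"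
  obtains h where "\<And>i. i \<in> Basis \<Longrightarrow> smooth_on (ball x0 r) (h i)"
    and "\<And>i. i \<in> Basis \<Longrightarrow> h i x0 = frechet_derivative f (at x0) i"
    and "\<And>x. x \<in> ball x0 r \<Longrightarrow> f x = f x0 + (\<Sum>i\<in>Basis. ((x - x0) \<bullet> i) * h i x)"
proof
  let ?p = "\<lambda>i x. frechet_derivative f (at x) i"
  let ?h = "\<lambda>i x. integral {0..1} (\<lambda>t. ?p i (x0 + t *\<^sub>R (x - x0)))"
  note d = smooth_on_derivative[OF assms(1)]
  show "smooth_on (ball x0 r) (?h i)" if "i \<in> Basis" for i
    unfolding smooth_on_def
  proof
    fix k
    have "Ck_on k (ball x0 r) (?p i)" using d(2)[OF that] by (simp add: smooth_on_def)
    from Ck_on_segment_integral[OF this, of 0] show "Ck_on k (ball x0 r) (?h i)" by simp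
  qed
  show "?h i x0 = ?p i x0" for i by simp
  fix x assume x: "x \<in> ball x0 r"
  note seg = segment_in_ball[OF x]
  have cont: "continuous_on {0..1} (\<lambda>t. ?p i (x0 + t *\<^sub>R (x - x0)))" if "i \<in> Basis" for i
  proof -
    have "continuous_on (ball x0 r) (?p i)"
      using d(2)[OF that] unfolding smooth_on_def by (metis Ck_on.simps(1))
    then show ?thesis
      by (rule continuous_on_compose2) (use seg in \<open>auto intro!: continuous_intros simp del: mem_ball\<close>)
  qed
  have "((\<lambda>t. f (x0 + t *\<^sub>R (x - x0))) has_vector_derivative
      (\<Sum>i\<in>Basis. ((x - x0) \<bullet> i) * ?p i (x0 + t *\<^sub>R (x - x0)))) (at t within {0..1})"
    if t: "t \<in> {0..1}" for t
  proof -
    let ?z = "x0 + t *\<^sub>R (x - x0)"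
    have lin: "linear (frechet_derivative f (at ?z))"
      using d(1)[OF seg[OF t]] has_derivative_linear by blast
    have "((\<lambda>t. x0 + t *\<^sub>R (x - x0)) has_derivative (\<lambda>s. s *\<^sub>R (x - x0))) (at t)"
      by (auto intro!: derivative_eq_intros)
    from diff_chain_at[OF this d(1)[OF seg[OF t]]]
    have "((\<lambda>t. f (x0 + t *\<^sub>R (x - x0))) has_vector_derivative
        frechet_derivative f (at ?z) (x - x0)) (at t)"
      using lin by (simp add: o_def has_vector_derivative_def linear_scale)
    moreover have "frechet_derivative f (at ?z) (x - x0) = (\<Sum>i\<in>Basis. ((x - x0) \<bullet> i) * ?p i ?z)"
      using linear_basis_expansion[OF lin, of "x - x0"] by simp
    ultimately show ?thesis by (simp add: has_vector_derivative_at_within)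
  qed
  from fundamental_theorem_of_calculus[OF _ this]
  have "((\<lambda>t. \<Sum>i\<in>Basis. ((x - x0) \<bullet> i) * ?p i (x0 + t *\<^sub>R (x - x0))) has_integral f x - f x0) {0..1}"
    by simp
  moreover have "((\<lambda>t. \<Sum>i\<in>Basis. ((x - x0) \<bullet> i) * ?p i (x0 + t *\<^sub>R (x - x0))) has_integral
      (\<Sum>i\<in>Basis. ((x - x0) \<bullet> i) * ?h i x)) {0..1}"
    by (intro has_integral_sum has_integral_mult_right integrable_integral
        integrable_continuous_interval cont finite_Basis)
  ultimately have "f x - f x0 = (\<Sum>i\<in>Basis. ((x - x0) \<bullet> i) * ?h i x)"
    by (rule has_integral_unique)
  then show "f x = f x0 + (\<Sum>i\<in>Basis. ((x - x0) \<bullet> i) * ?h i x)" by simp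
qed

section \<open>Tangent vectors extend to vector fields\<close>

lemma chart_properties:
  assumes "smooth_manifold A" "(U, \<psi>) \<in> A"
  shows "open U" "open (\<psi> ` U)" "continuous_on U \<psi>" "continuous_on (\<psi> ` U) (inv_into U \<psi>)"
    "inj_on \<psi> U"
proof -
  have c: "is_chart (U, \<psi>)" using assms by (auto simp: smooth_manifold_def)
  then have h: "homeomorphism U (\<psi> ` U) \<psi> (inv_into U \<psi>)" by (simp add: is_chart_def)
  show "open U" "open (\<psi> ` U)" using c by (simp_all add: is_chart_def)
  show "continuous_on U \<psi>" "continuous_on (\<psi> ` U) (inv_into U \<psi>)"
    using h by (simp_all add: homeomorphism_def)
  show "inj_on \<psi> U" using h by (metis homeomorphism_apply1 inj_on_inverseI)
qed

lemma chart_around: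
  assumes "smooth_manifold A"
  obtains U \<psi> where "(U, \<psi>) \<in> A" "q \<in> U"
proof -
  have "q \<in> (\<Union>c\<in>A. fst c)" using assms by (simp add: smooth_manifold_def)
  then obtain c where "c \<in> A" "q \<in> fst c" by blast
  then show ?thesis using that[of "fst c" "snd c"] by simp
qed

lemma open_chart_image:
  assumes "smooth_manifold A" "(U, \<psi>) \<in> A" "open W" "W \<subseteq> U"
  shows "open (\<psi> ` W)"
proof -
  note c = chart_properties[OF assms(1,2)]
  have "\<psi> ` W = \<psi> ` U \<inter> inv_into U \<psi> -` W"
    using assms(4) c(5) by (auto simp: inv_into_f_f subset_eq)
  then show ?thesis using continuous_open_preimage[OF c(4,2) assms(3)] by simp
qed

lemma smooth_fun_in_chart:
  "smooth_fun A f \<Longrightarrow> (U, \<psi>) \<in> A \<Longrightarrow> smooth_on (\<psi> ` U) (\<lambda>x. f (inv_into U \<psi> x))"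
  by (auto simp: smooth_fun_def o_def)

text \<open>It suffices to test smoothness near each point in one chart; the transition maps carry it over to
the others.\<close>

lemma smooth_fun_local:
  assumes M: "smooth_manifold A"
    and loc: "\<And>q. \<exists>U \<psi> W. (U, \<psi>) \<in> A \<and> open W \<and> q \<in> W \<and> W \<subseteq> U \<and>
      smooth_on (\<psi> ` W) (\<lambda>x. f (inv_into U \<psi> x))"
  shows "smooth_fun A f"
proof -
  have "smooth_on (\<theta> ` V) (\<lambda>x. f (inv_into V \<theta> x))" if V: "(V, \<theta>) \<in> A" for V \<theta>
  proof (rule smooth_on_local)
    fix x assume "x \<in> \<theta> ` V"
    then obtain q where q: "q \<in> V" "x = \<theta> q" by auto
    from loc[of q] obtain U \<psi> W where U: "(U, \<psi>) \<in> A" "open W" "q \<in> W" "W \<subseteq> U"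
      and sm: "smooth_on (\<psi> ` W) (\<lambda>x. f (inv_into U \<psi> x))" by blast
    note cU = chart_properties[OF M U(1)] and cV = chart_properties[OF M V]
    have op: "open (\<theta> ` (V \<inter> W))" using U(2) cV(1) by (intro open_chart_image[OF M V]) auto
    have "smooth_compatible (V, \<theta>) (U, \<psi>)" using M U(1) V by (auto simp: smooth_manifold_def)
    then have trans: "smooth_on (\<theta> ` (V \<inter> W)) (\<lambda>x. \<psi> (inv_into V \<theta> x))"
      using U(4) by (auto simp: smooth_compatible_def o_def intro: smooth_on_subset)
    have "smooth_on (\<theta> ` (V \<inter> W)) (\<lambda>x. f (inv_into U \<psi> (\<psi> (inv_into V \<theta> x))))"
      by (rule smooth_on_compose[OF op open_chart_image[OF M U(1,2,4)] _ sm trans])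
        (use cV(5) in \<open>auto simp: inv_into_f_f\<close>)
    then have "smooth_on (\<theta> ` (V \<inter> W)) (\<lambda>x. f (inv_into V \<theta> x))"
      using cU(5) cV(5) U(4)
      by (subst smooth_on_cong[OF op]) (auto simp: inv_into_f_f subset_eq)
    then show "\<exists>T. open T \<and> x \<in> T \<and> smooth_on T (\<lambda>x. f (inv_into V \<theta> x))"
      using op q U(3) by blast
  qed
  then show ?thesis by (auto simp: smooth_fun_def o_def)
qed

lemma smooth_fun_const: "smooth_manifold A \<Longrightarrow> smooth_fun A (\<lambda>q. c)"
  by (auto simp: smooth_fun_def o_def intro!: smooth_on_const dest: chart_properties(2))

lemma smooth_fun_add:
  "smooth_manifold A \<Longrightarrow> smooth_fun A f \<Longrightarrow> smooth_fun A h \<Longrightarrow> smooth_fun A (f + h)"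
  by (fastforce simp: smooth_fun_def o_def intro!: smooth_on_add dest: chart_properties(2))

lemma smooth_fun_mult:
  "smooth_manifold A \<Longrightarrow> smooth_fun A f \<Longrightarrow> smooth_fun A h \<Longrightarrow> smooth_fun A (f * h)"
  by (fastforce simp: smooth_fun_def o_def intro!: smooth_on_mult dest: chart_properties(2))

lemma smooth_fun_scaleR:
  "smooth_manifold A \<Longrightarrow> smooth_fun A f \<Longrightarrow> smooth_fun A (c *\<^sub>R f)"
  using smooth_fun_mult[OF _ smooth_fun_const[of A c], of f]
  by (simp add: fun_eq_iff times_fun_def scaleR_fun_def)

lemma sum_fun_apply: "(\<Sum>i\<in>I. f i) x = (\<Sum>i\<in>I. f i x :: real)"
  by (induction I rule: infinite_finite_induct) auto

lemma smooth_fun_sum: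
  assumes "smooth_manifold A" "finite I" "\<And>i. i \<in> I \<Longrightarrow> smooth_fun A (f i)"
  shows "smooth_fun A (\<Sum>i\<in>I. f i)"
  using assms(2,3)
proof (induction I)
  case empty
  show ?case using smooth_fun_const[OF assms(1), of 0] by (simp add: zero_fun_def)
next
  case (insert i I)
  then have "smooth_fun A (f i + (\<Sum>i\<in>I. f i))" by (intro smooth_fun_add[OF assms(1)]) auto
  moreover have "(\<Sum>i\<in>insert i I. f i) = f i + (\<Sum>i\<in>I. f i)"
    using insert.hyps by (rule sum.insert)
  ultimately show ?case by argo
qed

definition extend_by_zero :: "'m set \<Rightarrow> ('m \<Rightarrow> 'e) \<Rightarrow> ('e \<Rightarrow> real) \<Rightarrow> 'm \<Rightarrow> real" where
  "extend_by_zero U \<psi> F = (\<lambda>q. if q \<in> U then F (\<psi> q) else 0)"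

text \<open>The set of points of \<open>U\<close> that correspond to the closed ball of radius \<open>s\<close> is compact, hence closed
because the manifold is Hausdorff.  So the extension is locally either \<open>F\<close> in the chart or zero.\<close>

lemma smooth_fun_extend_by_zero:
  fixes A :: "('m::{t2_space,second_countable_topology}, 'e::euclidean_space) chart set"
  assumes M: "smooth_manifold A" and U: "(U, \<psi>) \<in> A"
    and r: "ball x0 r \<subseteq> \<psi> ` U" "s < r"
    and F: "smooth_on (ball x0 r) F" "\<And>x. x \<notin> cball x0 s \<Longrightarrow> F x = 0"
  shows "smooth_fun A (extend_by_zero U \<psi> F)"
proof (rule smooth_fun_local[OF M])
  fix q
  note c = chart_properties[OF M U]
  let ?K = "inv_into U \<psi> ` cball x0 s"
  have sub: "cball x0 s \<subseteq> \<psi> ` U" using r by force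
  then have "compact ?K"
    by (intro compact_continuous_image continuous_on_subset[OF c(4)]) auto
  then have closed: "closed ?K" by (rule compact_imp_closed)
  show "\<exists>V \<theta> W. (V, \<theta>) \<in> A \<and> open W \<and> q \<in> W \<and> W \<subseteq> V \<and>
      smooth_on (\<theta> ` W) (\<lambda>x. extend_by_zero U \<psi> F (inv_into V \<theta> x))"
  proof (cases "q \<in> ?K")
    case True
    let ?W = "U \<inter> \<psi> -` ball x0 r"
    obtain x where x: "x \<in> cball x0 s" "q = inv_into U \<psi> x" using True by blast
    have "x \<in> \<psi> ` U" using x sub by blast
    then have "q \<in> U" "\<psi> q = x" using x by (simp_all add: inv_into_into f_inv_into_f)
    then have qW: "q \<in> ?W" using x r(2) by auto
    have op: "open ?W" by (rule continuous_open_preimage[OF c(3,1) open_ball])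
    have im: "\<psi> ` ?W = ball x0 r" using r(1) by blast
    have "extend_by_zero U \<psi> F (inv_into U \<psi> x) = F x" if "x \<in> ball x0 r" for x
    proof -
      have "x \<in> \<psi> ` U" using that r(1) by blast
      then show ?thesis by (simp add: extend_by_zero_def inv_into_into f_inv_into_f)
    qed
    from iffD2[OF smooth_on_cong[OF open_ball this] F(1)]
    have sm: "smooth_on (\<psi> ` ?W) (\<lambda>x. extend_by_zero U \<psi> F (inv_into U \<psi> x))"
      unfolding im .
    show ?thesis
      by (rule exI[of _ U], rule exI[of _ \<psi>], rule exI[of _ ?W])
        (intro conjI U op qW Int_lower1 sm)
  next
    case False
    obtain V \<theta> where V: "(V, \<theta>) \<in> A" "q \<in> V"
      using chart_around[OF M] by blast
    note cV = chart_properties[OF M V(1)]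
    let ?W = "V - ?K"
    have op: "open ?W" using cV(1) closed by (rule open_Diff)
    have zero: "extend_by_zero U \<psi> F q' = 0" if "q' \<notin> ?K" for q'
    proof (cases "q' \<in> U")
      case True
      then have "inv_into U \<psi> (\<psi> q') = q'" using c(5) by simp
      then have "\<psi> q' \<notin> cball x0 s" using that by (metis image_eqI)
      then show ?thesis by (simp add: extend_by_zero_def F(2))
    qed (simp add: extend_by_zero_def)
    have "smooth_on (\<theta> ` ?W) (\<lambda>x. extend_by_zero U \<psi> F (inv_into V \<theta> x))"
      by (subst smooth_on_cong[where g = "\<lambda>x. 0"])
        (use cV(5) open_chart_image[OF M V(1) op] in
          \<open>auto simp: inv_into_f_f zero intro: smooth_on_const\<close>)
    then show ?thesis using V op False by blast
  qed
qed

lemma tangent_spaceD: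
  assumes "v \<in> tangent_space A p"
  shows "smooth_fun A f \<Longrightarrow> smooth_fun A h \<Longrightarrow> v (f + h) = v f + v h"
    and "smooth_fun A f \<Longrightarrow> v (c *\<^sub>R f) = c * v f"
    and "smooth_fun A f \<Longrightarrow> smooth_fun A h \<Longrightarrow> v (f * h) = f p * v h + h p * v f"
    and "\<not> smooth_fun A f \<Longrightarrow> v f = 0"
  using assms by (auto simp: tangent_space_def)

lemma tangent_vector_const:
  assumes "smooth_manifold A" "v \<in> tangent_space A p"
  shows "v (\<lambda>q. c) = 0"
proof -
  note [simp] = smooth_fun_const[OF assms(1)]
  have "v ((\<lambda>q. 1) * (\<lambda>q. 1)) = v (\<lambda>q. 1) + v (\<lambda>q. 1)"
    by (subst tangent_spaceD(3)[OF assms(2)]) auto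
  moreover have "(\<lambda>q. 1) * (\<lambda>q. 1) = (\<lambda>q::'a. 1::real)" by (simp add: times_fun_def)
  ultimately have "v (\<lambda>q. 1) = 0" by simp
  moreover have "c *\<^sub>R (\<lambda>q::'a. 1::real) = (\<lambda>q. c)" by (simp add: scaleR_fun_def)
  ultimately show ?thesis using tangent_spaceD(2)[OF assms(2), of "\<lambda>q. 1" c] by simp
qed

lemma tangent_vector_sum:
  assumes "smooth_manifold A" "v \<in> tangent_space A p" "finite I" "\<And>i. i \<in> I \<Longrightarrow> smooth_fun A (f i)"
  shows "v (\<Sum>i\<in>I. f i) = (\<Sum>i\<in>I. v (f i))"
  using assms(3,4)
proof (induction I)
  case empty
  then show ?case using tangent_vector_const[OF assms(1,2), of 0] by (simp add: zero_fun_def)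
next
  case (insert i I)
  have "v (f i + (\<Sum>i\<in>I. f i)) = v (f i) + v (\<Sum>i\<in>I. f i)"
    using insert.prems insert.hyps
    by (intro tangent_spaceD(1)[OF assms(2)] smooth_fun_sum[OF assms(1)]) auto
  moreover have "(\<Sum>i\<in>insert i I. f i) = f i + (\<Sum>i\<in>I. f i)"
    using insert.hyps by (rule sum.insert)
  ultimately have "v (\<Sum>i\<in>insert i I. f i) = v (f i) + v (\<Sum>i\<in>I. f i)" by metis
  moreover have "v (\<Sum>i\<in>I. f i) = (\<Sum>i\<in>I. v (f i))"
    using insert.prems by (intro insert.IH) auto
  ultimately show ?case using sum.insert[OF insert.hyps, of "\<lambda>i. v (f i)"] by metis
qed

text \<open>Hadamard's lemma writes \<open>f - f(p)\<close> in the chart as \<open>\<Sum>\<^sub>i (x - \<psi>(p))\<^sub>i h\<^sub>i\<close>.  The coordinate functions and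
the \<open>h\<^sub>i\<close> are defined in the chart only, but \<open>b\<^sup>2 (f - f(p))\<close> is a sum of products of the globally
smooth functions \<open>b (x - \<psi>(p))\<^sub>i\<close> and \<open>b h\<^sub>i\<close>, to which the Leibniz rule applies.\<close>

lemma tangent_vector_in_coordinates:
  fixes A :: "('m::{t2_space,second_countable_topology}, 'e::euclidean_space) chart set"
  assumes M: "smooth_manifold A" and U: "(U, \<psi>) \<in> A" "p \<in> U"
    and r: "ball (\<psi> p) r \<subseteq> \<psi> ` U" "0 < s" "s < r"
    and b: "smooth_on UNIV b" "b (\<psi> p) = 1" "\<And>x. x \<notin> cball (\<psi> p) s \<Longrightarrow> b x = 0"
    and v: "v \<in> tangent_space A p" and f: "smooth_fun A f"
  shows "v f = (\<Sum>i\<in>Basis. v (extend_by_zero U \<psi> (\<lambda>x. b x * ((x + - \<psi> p) \<bullet> i))) *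
    frechet_derivative (\<lambda>x. f (inv_into U \<psi> x)) (at (\<psi> p)) i)"
proof -
  note c = chart_properties[OF M U(1)]
  let ?F = "\<lambda>x. f (inv_into U \<psi> x)"
  have F: "smooth_on (ball (\<psi> p) r) ?F"
    using smooth_fun_in_chart[OF f U(1)] r(1) by (rule smooth_on_subset)
  have "0 < r" using r by simp
  from hadamard[OF F this] obtain h where
    h: "\<And>i. i \<in> Basis \<Longrightarrow> smooth_on (ball (\<psi> p) r) (h i)"
      "\<And>i. i \<in> Basis \<Longrightarrow> h i (\<psi> p) = frechet_derivative ?F (at (\<psi> p)) i"
      "\<And>x. x \<in> ball (\<psi> p) r \<Longrightarrow> ?F x = ?F (\<psi> p) + (\<Sum>i\<in>Basis. ((x - \<psi> p) \<bullet> i) * h i x)"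
    by blast
  let ?B = "extend_by_zero U \<psi> b"
  let ?X = "\<lambda>i. extend_by_zero U \<psi> (\<lambda>x. b x * ((x + - \<psi> p) \<bullet> i))"
  let ?H = "\<lambda>i. extend_by_zero U \<psi> (\<lambda>x. b x * h i x)"
  let ?g = "f + (\<lambda>q. - f p)"
  have b': "smooth_on (ball (\<psi> p) r) b" using b(1) smooth_on_subset by blast
  have B: "smooth_fun A ?B"
    by (rule smooth_fun_extend_by_zero[OF M U(1) r(1,3)]) (use b b' in auto)
  have X: "smooth_fun A (?X i)" for i
  proof (rule smooth_fun_extend_by_zero[OF M U(1) r(1,3)])
    show "smooth_on (ball (\<psi> p) r) (\<lambda>x. b x * ((x + - \<psi> p) \<bullet> i))"
      by (intro smooth_on_mult smooth_on_bilinear[OF _ bounded_bilinear_inner] smooth_on_add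
          smooth_on_id smooth_on_const b' open_ball)
  qed (simp add: b(3))
  have H: "smooth_fun A (?H i)" if "i \<in> Basis" for i
    by (rule smooth_fun_extend_by_zero[OF M U(1) r(1,3)])
      (use b b' h(1)[OF that] in \<open>auto intro!: smooth_on_mult\<close>)
  have g: "smooth_fun A ?g" by (intro smooth_fun_add M f smooth_fun_const)
  have Bg: "smooth_fun A (?B * ?g)" by (intro smooth_fun_mult M B g)
  have XH: "smooth_fun A (?X i * ?H i)" if "i \<in> Basis" for i
    by (intro smooth_fun_mult M X H that)
  have Bp: "?B p = 1" using U(2) b(2) by (simp add: extend_by_zero_def)
  \<comment> \<open>One factor b for each of the two functions in a product.\<close>
  have "?B * (?B * ?g) = (\<Sum>i\<in>Basis. ?X i * ?H i)"
  proof
    fix q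
    have "b (\<psi> q) * (b (\<psi> q) * (f q - f p))
        = (\<Sum>i\<in>Basis. b (\<psi> q) * ((\<psi> q - \<psi> p) \<bullet> i) * (b (\<psi> q) * h i (\<psi> q)))" if "q \<in> U"
    proof (cases "\<psi> q \<in> ball (\<psi> p) r")
      case True
      have "f q - f p = (\<Sum>i\<in>Basis. ((\<psi> q - \<psi> p) \<bullet> i) * h i (\<psi> q))"
        using h(3)[OF True] that U(2) c(5) by simp
      then show ?thesis by (simp add: sum_distrib_left mult_ac)
    next
      case False
      then have "\<psi> q \<notin> cball (\<psi> p) s" using r(3) by auto
      then show ?thesis by (simp add: b(3))
    qed
    then show "(?B * (?B * ?g)) q = (\<Sum>i\<in>Basis. ?X i * ?H i) q"
      by (simp add: extend_by_zero_def sum_fun_apply)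
  qed
  moreover have "v (?B * (?B * ?g)) = v (?B * ?g)"
    using tangent_spaceD(3)[OF v B Bg] Bp by simp
  moreover have "v (?B * ?g) = v ?g"
    using tangent_spaceD(3)[OF v B g] Bp by simp
  moreover have "v ?g = v f"
    using tangent_spaceD(1)[OF v f smooth_fun_const[OF M]] tangent_vector_const[OF M v] by simp
  ultimately have "v f = v (\<Sum>i\<in>Basis. ?X i * ?H i)" by simp
  also have "\<dots> = (\<Sum>i\<in>Basis. v (?X i * ?H i))"
    by (rule tangent_vector_sum[OF M v finite_Basis XH])
  also have "\<dots> = (\<Sum>i\<in>Basis. v (?X i) * frechet_derivative ?F (at (\<psi> p)) i)"
  proof (rule sum.cong[OF refl])
    fix i :: 'e assume i: "i \<in> Basis"
    have "?X i p = 0" "?H i p = frechet_derivative ?F (at (\<psi> p)) i"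
      using U(2) b(2) h(2)[OF i] by (simp_all add: extend_by_zero_def)
    then show "v (?X i * ?H i) = v (?X i) * frechet_derivative ?F (at (\<psi> p)) i"
      using tangent_spaceD(3)[OF v X H[OF i], of i] by simp
  qed
  finally show ?thesis .
qed

text \<open>Take the constant coefficient field with the coordinates of \<open>v\<close> in a chart and multiply it by a bump
function.  That its value at \<open>p\<close> is the given derivation is the preceding lemma.\<close>

lemma tangent_vector_extends:
  fixes A :: "('m::{t2_space,second_countable_topology}, 'e::euclidean_space) chart set"
  assumes M: "smooth_manifold A" and v: "v \<in> tangent_space A p"
  obtains X where "vector_field A X" "X p = v"
proof -
  obtain U \<psi> where U: "(U, \<psi>) \<in> A" "p \<in> U"
    using chart_around[OF M] by blast
  note c = chart_properties[OF M U(1)]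
  obtain r where r: "r > 0" "ball (\<psi> p) r \<subseteq> \<psi> ` U"
    using c(2) U(2) open_contains_ball by blast
  define s where "s = r / 2"
  have s: "0 < s" "s < r" using r(1) by (auto simp: s_def)
  obtain b :: "'e \<Rightarrow> real" where
    b: "smooth_on UNIV b" "b (\<psi> p) = 1" "\<And>x. x \<notin> cball (\<psi> p) s \<Longrightarrow> b x = 0"
    using bump_function[OF s(1)] by blast
  define a where "a i = v (extend_by_zero U \<psi> (\<lambda>x. b x * ((x + - \<psi> p) \<bullet> i)))" for i
  let ?d = "\<lambda>f x. frechet_derivative (\<lambda>x. f (inv_into U \<psi> x)) (at x)"
  let ?G = "\<lambda>f x. b x * (\<Sum>i\<in>Basis. a i * ?d f x i)"
  define X where "X = (\<lambda>q f. if smooth_fun A f then extend_by_zero U \<psi> (?G f) q else 0)"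
  have der: "((\<lambda>x. f (inv_into U \<psi> x)) has_derivative ?d f (\<psi> q)) (at (\<psi> q))"
    if "smooth_fun A f" "q \<in> U" for f q
    using smooth_on_derivative(1)[OF smooth_fun_in_chart[OF that(1) U(1)], of "\<psi> q"] that(2) by simp
  have tangent: "X q \<in> tangent_space A q" for q
  proof -
    have "?d (f + h) (\<psi> q) = (\<lambda>w. ?d f (\<psi> q) w + ?d h (\<psi> q) w)"
      if "smooth_fun A f" "smooth_fun A h" "q \<in> U" for f h
      using frechet_derivative_at[OF has_derivative_add[OF der[OF that(1,3)] der[OF that(2,3)]]]
      by simp
    then have "X q (f + h) = X q f + X q h" if "smooth_fun A f" "smooth_fun A h" for f h
      using that by (simp add: X_def extend_by_zero_def smooth_fun_add[OF M] algebra_simps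
          sum.distrib)
    moreover have "?d (k *\<^sub>R f) (\<psi> q) = (\<lambda>w. k * ?d f (\<psi> q) w)"
      if "smooth_fun A f" "q \<in> U" for f k
      using frechet_derivative_at[OF has_derivative_mult_right[OF der[OF that], of k]]
      by simp
    then have "X q (k *\<^sub>R f) = k * X q f" if "smooth_fun A f" for f k
      using that by (simp add: X_def extend_by_zero_def smooth_fun_scaleR[OF M] mult_ac
          sum_distrib_left)
    moreover have "?d (f * h) (\<psi> q) = (\<lambda>w. f q * ?d h (\<psi> q) w + ?d f (\<psi> q) w * h q)"
      if "smooth_fun A f" "smooth_fun A h" "q \<in> U" for f h
      using frechet_derivative_at[OF has_derivative_mult[OF der[OF that(1,3)] der[OF that(2,3)]]]
        that(3) c(5) by simp
    then have "X q (f * h) = f q * X q h + h q * X q f" if "smooth_fun A f" "smooth_fun A h" for f h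
      using that by (simp add: X_def extend_by_zero_def smooth_fun_mult[OF M] algebra_simps
          sum.distrib sum_distrib_left)
    ultimately show ?thesis by (simp add: tangent_space_def X_def)
  qed
  have "smooth_fun A (along X f)" if f: "smooth_fun A f" for f
  proof -
    have "along X f = extend_by_zero U \<psi> (?G f)" using f by (simp add: along_def X_def)
    moreover have "smooth_fun A (extend_by_zero U \<psi> (?G f))"
    proof (rule smooth_fun_extend_by_zero[OF M U(1) r(2) s(2)])
      show "smooth_on (ball (\<psi> p) r) (?G f)"
        by (intro smooth_on_mult smooth_on_sum smooth_on_const finite_Basis open_ball
            smooth_on_subset[OF b(1)] subset_UNIV
            smooth_on_subset[OF smooth_on_derivative(2)[OF smooth_fun_in_chart[OF f U(1)]] r(2)])
    qed (simp add: b(3))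
    ultimately show ?thesis by simp
  qed
  then have "vector_field A X" using tangent by (simp add: vector_field_def)
  moreover have "X p = v"
  proof
    fix f
    show "X p f = v f"
    proof (cases "smooth_fun A f")
      case True
      then show ?thesis
        using tangent_vector_in_coordinates[OF M U r(2) s b v True] U(2) b(2)
        by (simp add: X_def extend_by_zero_def a_def)
    qed (simp add: X_def tangent_spaceD(4)[OF v])
  qed
  ultimately show ?thesis using that by blast
qed

section \<open>Algebra of curvature operators\<close>

lemma eq_neg_self_imp_zero:
  fixes u :: "'a::real_vector"
  assumes "u = - u"
  shows "u = 0"
proof -
  have "u + u = 0" using assms by (simp only: eq_neg_iff_add_eq_0)
  then have "2 *\<^sub>R u = 0" by (simp only: scaleR_2)
  then show ?thesis by simp
qed

text \<open>The curvature is treated as an operation on the real vector space \<open>V\<close> of all vector fields.  The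
metric of two vector fields is a function on the manifold; its argument is the parameter \<open>q\<close>, so that
equations between values of \<open>g\<close> are equations between real numbers.\<close>

locale curvature_operator =
  fixes V :: "'v::real_vector set"
    and g :: "'v \<Rightarrow> 'v \<Rightarrow> 'q \<Rightarrow> real"
    and R :: "'v \<Rightarrow> 'v \<Rightarrow> 'v \<Rightarrow> 'v"
  assumes V: "subspace V"
    and g_add: "x \<in> V \<Longrightarrow> y \<in> V \<Longrightarrow> z \<in> V \<Longrightarrow> g (x + y) z q = g x z q + g y z q"
    and g_sym: "x \<in> V \<Longrightarrow> y \<in> V \<Longrightarrow> g x y q = g y x q"
    and g_nondegenerate: "x \<in> V \<Longrightarrow> (\<And>y q. y \<in> V \<Longrightarrow> g x y q = 0) \<Longrightarrow> x = 0"
    and R_in: "x \<in> V \<Longrightarrow> y \<in> V \<Longrightarrow> z \<in> V \<Longrightarrow> R x y z \<in> V"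
    and R_antisym: "x \<in> V \<Longrightarrow> y \<in> V \<Longrightarrow> z \<in> V \<Longrightarrow> R y x z = - R x y z"
    and bianchi: "x \<in> V \<Longrightarrow> y \<in> V \<Longrightarrow> z \<in> V \<Longrightarrow> R x y z + R y z x + R z x y = 0"
    and R_skew: "x \<in> V \<Longrightarrow> y \<in> V \<Longrightarrow> z \<in> V \<Longrightarrow> w \<in> V \<Longrightarrow>
      g (R x y z) w q = - g (R x y w) z q"
begin

lemmas V_closed [simp] = subspace_add[OF V] subspace_diff[OF V] subspace_neg[OF V] subspace_0[OF V]
declare R_in [simp]

lemma g_zero: "x \<in> V \<Longrightarrow> g 0 x q = 0"
  using g_add[of 0 0 x q] by simp

lemma g_minus: "x \<in> V \<Longrightarrow> y \<in> V \<Longrightarrow> g (- x) y q = - g x y q"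
  using g_add[of x "- x" y q] g_zero[of y q] by simp

lemma g_diff: "x \<in> V \<Longrightarrow> y \<in> V \<Longrightarrow> z \<in> V \<Longrightarrow> g (x - y) z q = g x z q - g y z q"
  using g_add[of x "- y" z q] g_minus[of y z q] by simp

lemma g_cancel:
  assumes "x \<in> V" "y \<in> V" "\<And>w q. w \<in> V \<Longrightarrow> g x w q = g y w q"
  shows "x = y"
  using g_nondegenerate[of "x - y"] assms by (simp add: g_diff)

lemma R_zero:
  assumes "x \<in> V" "y \<in> V"
  shows "R x y 0 = 0"
proof (rule g_nondegenerate)
  fix w q assume "w \<in> V"
  then have "g (R x y w) 0 q = 0" using assms by (simp add: g_sym[of _ 0] g_zero)
  then show "g (R x y 0) w q = 0" using R_skew[of x y 0 w q] \<open>w \<in> V\<close> assms by simp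
qed (use assms in simp)

text \<open>The classical octahedron argument: a combination of the four Bianchi identities obtained by
cyclically permuting \<open>x, y, z, w\<close>, with the skew symmetries in both pairs.\<close>

lemma pair_symmetry:
  assumes [simp]: "x \<in> V" "y \<in> V" "z \<in> V" "w \<in> V"
  shows "g (R x y z) w q = g (R z w x) y q"
proof -
  let ?r = "\<lambda>x y z w. g (R x y z) w q"
  have b: "?r a b c d + ?r b c a d + ?r c a b d = 0"
    if "a \<in> V" "b \<in> V" "c \<in> V" "d \<in> V" for a b c d
    using arg_cong[OF bianchi[OF that(1-3)], of "\<lambda>u. g u d q"] that
    by (simp add: g_add g_zero)
  have s: "?r a b c d = - ?r b a c d" if "a \<in> V" "b \<in> V" "c \<in> V" "d \<in> V" for a b c d
    using R_antisym[of b a c] that by (simp add: g_minus)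
  have k: "?r a b c d = - ?r a b d c" if "a \<in> V" "b \<in> V" "c \<in> V" "d \<in> V" for a b c d
    by (rule R_skew[OF that])
  note xyzw = assms
  show ?thesis
    using b[OF xyzw] b[OF xyzw(2,3,4,1)] b[OF xyzw(3,4,1,2)] b[OF xyzw(4,1,2,3)]
      k[OF xyzw(1,2,4,3)] k[OF xyzw(3,4,2,1)] k[OF xyzw(2,3,4,1)] k[OF xyzw(4,1,3,2)]
      s[OF xyzw(1,3,4,2)] k[OF xyzw(3,1,4,2)] s[OF xyzw(2,4,1,3)] k[OF xyzw(4,2,1,3)]
    by linarith
qed

text \<open>Pair symmetry turns the two hypotheses on \<open>J\<close> into \<open>R(Jx,y) = R(x,Jy)\<close>.  Let \<open>D(x,y,z)\<close> be the
defect \<open>R(Jx,y)z - J(R(x,y)z)\<close>.  Subtracting the image under \<open>J\<close> of the Bianchi identity for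
\<open>x, y, z\<close> from the Bianchi identity for \<open>Jx, y, z\<close> shows that a cyclic permutation of the arguments
changes the sign of \<open>D\<close>.  The third power of this permutation is the identity, so \<open>D = -D\<close>.\<close>

lemma commuting_symmetric_pure:
  assumes J_in [simp]: "\<And>x. x \<in> V \<Longrightarrow> J x \<in> V"
    and J_add: "\<And>x y. x \<in> V \<Longrightarrow> y \<in> V \<Longrightarrow> J (x + y) = J x + J y"
    and J_commute: "\<And>x y z. x \<in> V \<Longrightarrow> y \<in> V \<Longrightarrow> z \<in> V \<Longrightarrow> R x y (J z) = J (R x y z)"
    and J_sym: "\<And>x y q. x \<in> V \<Longrightarrow> y \<in> V \<Longrightarrow> g (J x) y q = g x (J y) q"
    and xyz: "x \<in> V" "y \<in> V" "z \<in> V"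
  shows "R (J x) y z = J (R x y z)"
proof -
  have shift: "R (J x) y z = R x (J y) z" if [simp]: "x \<in> V" "y \<in> V" "z \<in> V" for x y z
  proof (rule g_cancel)
    fix w q assume [simp]: "w \<in> V"
    have "g (R (J x) y z) w q = g (J (R z w x)) y q"
      using pair_symmetry[of "J x" y z w q] by (simp add: J_commute)
    also have "\<dots> = g (R x (J y) z) w q"
      using pair_symmetry[of x "J y" z w q] by (simp add: J_sym)
    finally show "g (R (J x) y z) w q = g (R x (J y) z) w q" .
  qed simp_all
  define D where "D x y z = R (J x) y z - J (R x y z)" for x y z
  have J0: "J 0 = 0" using J_add[of 0 0] by simp
  have cyclic: "D x y z + D z x y = 0" if [simp]: "x \<in> V" "y \<in> V" "z \<in> V" for x y z
  proof -
    have 1: "R (J x) y z + J (R y z x) + R (J z) x y = 0"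
      using bianchi[of "J x" y z] shift[of z x y] by (simp add: J_commute)
    have "J (R x y z + R y z x + R z x y) = 0" by (simp add: bianchi J0)
    then have 2: "J (R x y z) + J (R y z x) + J (R z x y) = 0" by (simp add: J_add)
    have "D x y z + D z x y = (R (J x) y z + J (R y z x) + R (J z) x y)
        - (J (R x y z) + J (R y z x) + J (R z x y))"
      by (simp add: D_def)
    then show ?thesis by (simp only: 1 2 diff_zero)
  qed
  have "D x y z = - D z x y" "D z x y = - D y z x" "D y z x = - D x y z"
    using cyclic[OF xyz] cyclic[OF xyz(3,1,2)] cyclic[OF xyz(2,3,1)]
    by (simp_all only: eq_neg_iff_add_eq_0)
  then have "D x y z = - D x y z" by (metis minus_minus)
  from eq_neg_self_imp_zero[OF this] show ?thesis by (simp add: D_def)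
qed

text \<open>The quaternion relations are assumed on the image of the curvature operators only, because the
endomorphisms of a contact structure satisfy them elsewhere only up to terms with Reeb fields.\<close>

lemma quaternionic_curvature_vanishes:
  assumes J_in: "\<And>x. x \<in> V \<Longrightarrow> J\<^sub>1 x \<in> V" "\<And>x. x \<in> V \<Longrightarrow> J\<^sub>2 x \<in> V" "\<And>x. x \<in> V \<Longrightarrow> J\<^sub>3 x \<in> V"
    and J_add: "\<And>x y. x \<in> V \<Longrightarrow> y \<in> V \<Longrightarrow> J\<^sub>1 (x + y) = J\<^sub>1 x + J\<^sub>1 y"
      "\<And>x y. x \<in> V \<Longrightarrow> y \<in> V \<Longrightarrow> J\<^sub>2 (x + y) = J\<^sub>2 x + J\<^sub>2 y"
      "\<And>x y. x \<in> V \<Longrightarrow> y \<in> V \<Longrightarrow> J\<^sub>3 (x + y) = J\<^sub>3 x + J\<^sub>3 y"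
    and commute: "\<And>x y z. x \<in> V \<Longrightarrow> y \<in> V \<Longrightarrow> z \<in> V \<Longrightarrow> R x y (J\<^sub>1 z) = J\<^sub>1 (R x y z)"
      "\<And>x y z. x \<in> V \<Longrightarrow> y \<in> V \<Longrightarrow> z \<in> V \<Longrightarrow> R x y (J\<^sub>2 z) = J\<^sub>2 (R x y z)"
      "\<And>x y z. x \<in> V \<Longrightarrow> y \<in> V \<Longrightarrow> z \<in> V \<Longrightarrow> R x y (J\<^sub>3 z) = J\<^sub>3 (R x y z)"
    and skew: "\<And>x y q. x \<in> V \<Longrightarrow> y \<in> V \<Longrightarrow> g (J\<^sub>1 x) y q = - g x (J\<^sub>1 y) q"
    and sym: "\<And>x y q. x \<in> V \<Longrightarrow> y \<in> V \<Longrightarrow> g (J\<^sub>2 x) y q = g x (J\<^sub>2 y) q"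
      "\<And>x y q. x \<in> V \<Longrightarrow> y \<in> V \<Longrightarrow> g (J\<^sub>3 x) y q = g x (J\<^sub>3 y) q"
    and quaternion: "\<And>x y z. x \<in> V \<Longrightarrow> y \<in> V \<Longrightarrow> z \<in> V \<Longrightarrow> J\<^sub>1 (J\<^sub>1 (R x y z)) = - R x y z"
      "\<And>x y z. x \<in> V \<Longrightarrow> y \<in> V \<Longrightarrow> z \<in> V \<Longrightarrow> J\<^sub>2 (J\<^sub>3 (R x y z)) = J\<^sub>1 (R x y z)"
      "\<And>x y z. x \<in> V \<Longrightarrow> y \<in> V \<Longrightarrow> z \<in> V \<Longrightarrow> J\<^sub>3 (J\<^sub>2 (R x y z)) = - J\<^sub>1 (R x y z)"
    and xyz: "x \<in> V" "y \<in> V" "z \<in> V"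
  shows "R x y z = 0"
proof -
  note [simp] = J_in
  note pure2 = commuting_symmetric_pure[OF J_in(2) J_add(2) commute(2) sym(1)]
  note pure3 = commuting_symmetric_pure[OF J_in(3) J_add(3) commute(3) sym(2)]
  have pure1: "R (J\<^sub>1 x) y z = J\<^sub>1 (R x y z)" if [simp]: "x \<in> V" "y \<in> V" "z \<in> V" for x y z
  proof -
    \<comment> \<open>The arguments J1 x and J2 (J3 x) may differ, but only by something orthogonal to the
      image of R, and this orthogonality passes to the first argument of R by pair symmetry.\<close>
    have "R (J\<^sub>1 x) y z = R (J\<^sub>2 (J\<^sub>3 x)) y z"
    proof (rule g_cancel)
      fix w q assume [simp]: "w \<in> V"
      have to_R: "g (R u y z) w q = - g u (R z w y) q" if [simp]: "u \<in> V" for u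
        using pair_symmetry[of u y z w q] R_skew[of z w u y q] g_sym[of u "R z w y" q] by simp
      have "g (J\<^sub>1 x) (R z w y) q = - g x (J\<^sub>1 (R z w y)) q" by (rule skew) simp_all
      also have "\<dots> = g x (J\<^sub>3 (J\<^sub>2 (R z w y))) q"
        using g_minus[of "J\<^sub>1 (R z w y)" x q]
        by (simp add: quaternion g_sym[of x])
      also have "\<dots> = g (J\<^sub>2 (J\<^sub>3 x)) (R z w y) q" by (simp add: sym)
      finally show "g (R (J\<^sub>1 x) y z) w q = g (R (J\<^sub>2 (J\<^sub>3 x)) y z) w q"
        by (simp add: to_R)
    qed simp_all
    also have "\<dots> = J\<^sub>1 (R x y z)" by (simp add: pure2 pure3 quaternion)
    finally show ?thesis .
  qed
  have anti: "R (J\<^sub>1 x) y z = - R x (J\<^sub>1 y) z" if [simp]: "x \<in> V" "y \<in> V" "z \<in> V" for x y z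
  proof (rule g_cancel)
    fix w q assume [simp]: "w \<in> V"
    have "g (R (J\<^sub>1 x) y z) w q = g (J\<^sub>1 (R z w x)) y q"
      using pair_symmetry[of "J\<^sub>1 x" y z w q] by (simp add: commute)
    also have "\<dots> = - g (R x (J\<^sub>1 y) z) w q"
      using pair_symmetry[of x "J\<^sub>1 y" z w q] by (simp add: skew)
    finally show "g (R (J\<^sub>1 x) y z) w q = g (- R x (J\<^sub>1 y) z) w q" by (simp add: g_minus)
  qed simp_all
  have J0: "J\<^sub>1 0 = 0" using J_add(1)[of 0 0] by simp
  have J_minus: "J\<^sub>1 (- u) = - J\<^sub>1 u" if "u \<in> V" for u
    using J_add(1)[of u "- u"] that by (simp add: J0 eq_neg_iff_add_eq_0 add.commute)
  have "J\<^sub>1 (R x y z) = - R x (J\<^sub>1 y) z" using anti[OF xyz] pure1[OF xyz] by simp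
  also have "\<dots> = R (J\<^sub>1 y) x z" using R_antisym[of x "J\<^sub>1 y" z] xyz by simp
  also have "\<dots> = J\<^sub>1 (- R x y z)" using pure1[of y x z] R_antisym[of x y z] xyz by simp
  also have "\<dots> = - J\<^sub>1 (R x y z)" using xyz by (simp add: J_minus)
  finally have "J\<^sub>1 (R x y z) = 0" by (rule eq_neg_self_imp_zero)
  then have "J\<^sub>1 (J\<^sub>1 (R x y z)) = 0" by (simp add: J0)
  then show ?thesis using quaternion(1)[OF xyz] by simp
qed

end

section \<open>The curvature of the Levi-Civita connection\<close>

lemma subspace_tangent_space: "subspace (tangent_space A p)"
  by (auto simp: subspace_def tangent_space_def algebra_simps)

lemma vector_fieldD:
  assumes "vector_field A X"
  shows "X p \<in> tangent_space A p" "smooth_fun A f \<Longrightarrow> smooth_fun A (along X f)"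
  using assms by (auto simp: vector_field_def)

lemma subspace_vector_fields:
  assumes M: "smooth_manifold A"
  shows "subspace {X. vector_field A X}"
proof (rule subspaceI)
  note sub = subspace_tangent_space[of A]
  show "0 \<in> {X. vector_field A X}"
    using subspace_0[OF sub] smooth_fun_const[OF M, of 0] by (simp add: vector_field_def along_def)
  show "X + Y \<in> {X. vector_field A X}"
    if "X \<in> {X. vector_field A X}" "Y \<in> {X. vector_field A X}" for X Y
  proof -
    have "along (X + Y) f = along X f + along Y f" for f
      by (rule ext) (simp add: along_def)
    then show ?thesis
      using that subspace_add[OF sub] smooth_fun_add[OF M] by (simp add: vector_field_def)
  qed
  show "c *\<^sub>R X \<in> {X. vector_field A X}" if "X \<in> {X. vector_field A X}" for c X
  proof -
    have "along (c *\<^sub>R X) f = c *\<^sub>R along X f" for f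
      by (rule ext) (simp add: along_def)
    then show ?thesis
      using that subspace_scale[OF sub] smooth_fun_scaleR[OF M] by (simp add: vector_field_def)
  qed
qed

lemma smooth_fun_diff:
  assumes "smooth_manifold A" "smooth_fun A f" "smooth_fun A h"
  shows "smooth_fun A (f - h)"
proof -
  have "f - h = f + (-1) *\<^sub>R h" by (rule ext) simp
  then show ?thesis using assms smooth_fun_add smooth_fun_scaleR by metis
qed

lemma tangent_vector_diff:
  assumes "smooth_manifold A" "v \<in> tangent_space A p" "smooth_fun A f" "smooth_fun A h"
  shows "v (f - h) = v f - v h"
proof -
  have "f - h = f + (-1) *\<^sub>R h" by (rule ext) simp
  moreover have "v (f + (-1) *\<^sub>R h) = v f + (-1) * v h"
    using tangent_spaceD(1)[OF assms(2,3) smooth_fun_scaleR[OF assms(1,4)], of "-1"]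
      tangent_spaceD(2)[OF assms(2,4), of "-1"] by simp
  ultimately show ?thesis by (metis mult_minus1 uminus_add_conv_diff add.commute)
qed

lemma along_lie_bracket:
  "along (lie_bracket X Y) f = along X (along Y f) - along Y (along X f)"
  by (rule ext) (simp add: along_def lie_bracket_def)

text \<open>In the Leibniz rule for the commutator the mixed terms \<open>(X f) (Y h)\<close> cancel.\<close>

lemma vector_field_lie_bracket:
  assumes M: "smooth_manifold A" and X: "vector_field A X" and Y: "vector_field A Y"
  shows "vector_field A (lie_bracket X Y)"
proof -
  note D = tangent_spaceD[OF vector_fieldD(1)[OF X]] tangent_spaceD[OF vector_fieldD(1)[OF Y]]
  note sm = vector_fieldD(2)[OF X] vector_fieldD(2)[OF Y] smooth_fun_mult[OF M]
  have add: "along Z (f + h) = along Z f + along Z h"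
    if "vector_field A Z" "smooth_fun A f" "smooth_fun A h" for Z f h
    using tangent_spaceD(1)[OF vector_fieldD(1)[OF that(1)] that(2,3)]
    by (intro ext) (simp add: along_def)
  have scale: "along Z (c *\<^sub>R f) = c *\<^sub>R along Z f" if "vector_field A Z" "smooth_fun A f" for Z c f
    using tangent_spaceD(2)[OF vector_fieldD(1)[OF that(1)] that(2)]
    by (intro ext) (simp add: along_def)
  have mult: "along Z (f * h) = f * along Z h + h * along Z f"
    if "vector_field A Z" "smooth_fun A f" "smooth_fun A h" for Z f h
    using tangent_spaceD(3)[OF vector_fieldD(1)[OF that(1)] that(2,3)]
    by (intro ext) (simp add: along_def)
  have zero: "along Z f = (\<lambda>q. 0)" if "vector_field A Z" "\<not> smooth_fun A f" for Z f
    using tangent_spaceD(4)[OF vector_fieldD(1)[OF that(1)] that(2)] by (simp add: along_def)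
  have "lie_bracket X Y p \<in> tangent_space A p" for p
    unfolding tangent_space_def
  proof (intro CollectI conjI allI impI)
    fix f h :: "'a \<Rightarrow> real" and c assume f: "smooth_fun A f"
    show "lie_bracket X Y p (c *\<^sub>R f) = c * lie_bracket X Y p f"
      by (simp add: lie_bracket_def scale X Y f D sm algebra_simps)
    assume h: "smooth_fun A h"
    show "lie_bracket X Y p (f + h) = lie_bracket X Y p f + lie_bracket X Y p h"
      by (simp add: lie_bracket_def add X Y f h D sm)
    show "lie_bracket X Y p (f * h) = f p * lie_bracket X Y p h + h p * lie_bracket X Y p f"
      by (simp add: lie_bracket_def mult X Y f h D sm) (simp add: along_def algebra_simps)
  next
    fix f assume "\<not> smooth_fun A f"
    then show "lie_bracket X Y p f = 0"
      using tangent_vector_const[OF M vector_fieldD(1)[OF X]]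
        tangent_vector_const[OF M vector_fieldD(1)[OF Y]]
      by (simp add: lie_bracket_def zero X Y)
  qed
  then show ?thesis
    by (simp add: vector_field_def along_lie_bracket smooth_fun_diff[OF M] sm)
qed

lemma jacobi_identity:
  assumes M: "smooth_manifold A"
    and X: "vector_field A X" and Y: "vector_field A Y" and Z: "vector_field A Z"
  shows "lie_bracket X (lie_bracket Y Z) + lie_bracket Y (lie_bracket Z X)
    + lie_bracket Z (lie_bracket X Y) = 0"
proof (intro ext)
  fix p f
  note lie = vector_field_lie_bracket[OF M]
  show "(lie_bracket X (lie_bracket Y Z) + lie_bracket Y (lie_bracket Z X)
    + lie_bracket Z (lie_bracket X Y)) p f = 0 p f"
  proof (cases "smooth_fun A f")
    case True
    have "lie_bracket U (lie_bracket V W) p f =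
        U p (along V (along W f)) - U p (along W (along V f))
        - V p (along W (along U f)) + W p (along V (along U f))"
      if "vector_field A U" "vector_field A V" "vector_field A W" for U V W
    proof -
      have "lie_bracket U (lie_bracket V W) p f
          = U p (along V (along W f) - along W (along V f)) - lie_bracket V W p (along U f)"
        unfolding lie_bracket_def[of U] along_lie_bracket ..
      also have "U p (along V (along W f) - along W (along V f))
          = U p (along V (along W f)) - U p (along W (along V f))"
        using that True by (intro tangent_vector_diff[OF M vector_fieldD(1)] vector_fieldD(2))
      finally show ?thesis by (simp add: lie_bracket_def)
    qed
    then show ?thesis using X Y Z by simp
  next
    case False
    have "lie_bracket U (lie_bracket V W) p f = 0"
      if "vector_field A U" "vector_field A V" "vector_field A W" for U V W
      by (rule tangent_spaceD(4)[OF vector_fieldD(1)[OF lie[OF that(1) lie[OF that(2,3)]]] False])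
    then show ?thesis using X Y Z by simp
  qed
qed

text \<open>Nondegeneracy at a point tests against all tangent vectors, and these are values of vector fields.\<close>

lemma metric_nondegenerate_on_vector_fields:
  fixes A :: "('m::{t2_space,second_countable_topology}, 'e::euclidean_space) chart set"
  assumes M: "smooth_manifold A" and g: "pseudo_riemannian_metric A g" and X: "vector_field A X"
    and zero: "\<And>Y q. vector_field A Y \<Longrightarrow> g q (X q) (Y q) = 0"
  shows "X = 0"
proof
  fix q
  have "g q (X q) w = 0" if "w \<in> tangent_space A q" for w
    using tangent_vector_extends[OF M that] zero by metis
  then show "X q = 0 q"
    using g vector_fieldD(1)[OF X, of q] by (auto simp: pseudo_riemannian_metric_def)
qed

lemma affine_connectionD:
  assumes "affine_connection A nabla" "vector_field A X" "vector_field A Y"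
  shows "vector_field A (nabla X Y)"
    and "vector_field A Z \<Longrightarrow> nabla (X + Y) Z = nabla X Z + nabla Y Z"
    and "vector_field A Z \<Longrightarrow> nabla X (Y + Z) = nabla X Y + nabla X Z"
  using assms unfolding affine_connection_def by blast+

text \<open>The Bianchi identity is the Jacobi identity after eliminating brackets by vanishing torsion.  The
skew symmetry follows by differentiating \<open>g(Z,W)\<close> twice: applying \<open>XY - YX - [X,Y] = 0\<close> to this
function, the mixed terms \<open>g(\<nabla>Z, \<nabla>W)\<close> cancel.\<close>

lemma curvature_operator_levi_civita:
  fixes A :: "('m::{t2_space,second_countable_topology}, 'e::euclidean_space) chart set"
  assumes M: "smooth_manifold A" and g: "pseudo_riemannian_metric A g"
    and LC: "levi_civita_connection A g nabla"
  shows "curvature_operator {X. vector_field A X} (\<lambda>X Y q. g q (X q) (Y q)) (curvature nabla)"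
proof
  note sub = subspace_vector_fields[OF M]
  have minus: "vector_field A (X - Y)" if "vector_field A X" "vector_field A Y" for X Y
    using subspace_diff[OF sub] that by simp
  have uminus: "vector_field A (- X)" if "vector_field A X" for X
    using subspace_neg[OF sub] that by simp
  have zero: "vector_field A 0" using subspace_0[OF sub] by simp
  note lie = vector_field_lie_bracket[OF M]
  have C: "affine_connection A nabla"
    and torsion: "\<And>X Y. vector_field A X \<Longrightarrow> vector_field A Y \<Longrightarrow> lie_bracket X Y = nabla X Y - nabla Y X"
    and compat: "\<And>X Y Z p. vector_field A X \<Longrightarrow> vector_field A Y \<Longrightarrow> vector_field A Z \<Longrightarrow>
      along X (\<lambda>q. g q (Y q) (Z q)) p = g p (nabla X Y p) (Z p) + g p (Y p) (nabla X Z p)"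
    using LC by (auto simp: levi_civita_connection_def)
  note nabla = affine_connectionD(1)[OF C]
  have diff1: "nabla (X - Y) Z = nabla X Z - nabla Y Z"
    if "vector_field A X" "vector_field A Y" "vector_field A Z" for X Y Z
    using affine_connectionD(2)[OF C minus[OF that(1,2)] that(2,3)] by (simp add: algebra_simps)
  have diff2: "nabla X (Y - Z) = nabla X Y - nabla X Z"
    if "vector_field A X" "vector_field A Y" "vector_field A Z" for X Y Z
    using affine_connectionD(3)[OF C that(1) minus[OF that(2,3)] that(3)] by (simp add: algebra_simps)
  have neg: "nabla (- X) Z = - nabla X Z" if "vector_field A X" "vector_field A Z" for X Z
    using diff1[OF zero that] diff1[OF zero zero that(2)] by simp
  have lie_swap: "lie_bracket Y X = - lie_bracket X Y" for X Y :: "'m vfield"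
    by (intro ext) (simp add: lie_bracket_def)
  have gadd: "g q (u + v) w = g q u w + g q v w"
    if "u \<in> tangent_space A q" "v \<in> tangent_space A q" "w \<in> tangent_space A q" for q u v w
    using g that by (auto simp: pseudo_riemannian_metric_def)
  have gsym: "g q u v = g q v u" if "u \<in> tangent_space A q" "v \<in> tangent_space A q" for q u v
    using g that unfolding pseudo_riemannian_metric_def by blast
  have smooth_g: "smooth_fun A (\<lambda>q. g q (X q) (Y q))" if "vector_field A X" "vector_field A Y" for X Y
    using g that by (auto simp: pseudo_riemannian_metric_def)
  note at = vector_fieldD(1)
  have gdiff: "g q (X q - Y q) (Z q) = g q (X q) (Z q) - g q (Y q) (Z q)"
    if "vector_field A X" "vector_field A Y" "vector_field A Z" for X Y Z q
    using gadd[OF at[OF minus[OF that(1,2)]] at[OF that(2)] at[OF that(3)], of q] by simp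
  have curv: "vector_field A (curvature nabla X Y Z)"
    if "vector_field A X" "vector_field A Y" "vector_field A Z" for X Y Z
    using that by (simp add: curvature_def minus nabla lie)
  show "subspace {X. vector_field A X}" by (rule sub)
  fix X Y Z :: "'m vfield" and q
  assume "X \<in> {X. vector_field A X}" then have X: "vector_field A X" by simp
  show "X = 0" if "\<And>Y q. Y \<in> {X. vector_field A X} \<Longrightarrow> g q (X q) (Y q) = 0"
    by (rule metric_nondegenerate_on_vector_fields[OF M g X]) (use that in simp)
  assume "Y \<in> {X. vector_field A X}" then have Y: "vector_field A Y" by simp
  show "g q (X q) (Y q) = g q (Y q) (X q)" by (rule gsym[OF at[OF X] at[OF Y]])
  assume "Z \<in> {X. vector_field A X}" then have Z: "vector_field A Z" by simp
  show "g q ((X + Y) q) (Z q) = g q (X q) (Z q) + g q (Y q) (Z q)"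
    using gadd[OF at[OF X] at[OF Y] at[OF Z]] by simp
  show "curvature nabla X Y Z \<in> {X. vector_field A X}" using curv[OF X Y Z] by simp
  show "curvature nabla Y X Z = - curvature nabla X Y Z"
    by (simp add: curvature_def lie_swap[of Y X] neg[OF lie[OF X Y] Z])
  show "curvature nabla X Y Z + curvature nabla Y Z X + curvature nabla Z X Y = 0"
  proof -
    have "curvature nabla X Y Z + curvature nabla Y Z X + curvature nabla Z X Y
        = (nabla X (nabla Y Z - nabla Z Y) - nabla (lie_bracket Y Z) X)
        + (nabla Y (nabla Z X - nabla X Z) - nabla (lie_bracket Z X) Y)
        + (nabla Z (nabla X Y - nabla Y X) - nabla (lie_bracket X Y) Z)"
      by (simp add: curvature_def diff2 nabla X Y Z)
    also have "\<dots> = lie_bracket X (lie_bracket Y Z) + lie_bracket Y (lie_bracket Z X)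
        + lie_bracket Z (lie_bracket X Y)"
      by (simp only: torsion[OF X lie[OF Y Z]] torsion[OF Y lie[OF Z X]] torsion[OF Z lie[OF X Y]]
          flip: torsion[OF X Y] torsion[OF Y Z] torsion[OF Z X])
    also have "\<dots> = 0" by (rule jacobi_identity[OF M X Y Z])
    finally show ?thesis .
  qed
  fix W :: "'m vfield"
  assume "W \<in> {X. vector_field A X}" then have W: "vector_field A W" by simp
  show "g q (curvature nabla X Y Z q) (W q) = - g q (curvature nabla X Y W q) (Z q)"
  proof -
    let ?G = "\<lambda>q. g q (Z q) (W q)"
    have second: "along U (along T ?G) q =
        g q (nabla U (nabla T Z) q) (W q) + g q (nabla T Z q) (nabla U W q)
        + (g q (nabla U Z q) (nabla T W q) + g q (Z q) (nabla U (nabla T W) q))"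
      if U: "vector_field A U" and T: "vector_field A T" for U T
    proof -
      have "along T ?G = (\<lambda>q. g q (nabla T Z q) (W q)) + (\<lambda>q. g q (Z q) (nabla T W q))"
        by (rule ext) (simp add: compat T Z W)
      then have "along U (along T ?G) q
          = along U (\<lambda>q. g q (nabla T Z q) (W q)) q + along U (\<lambda>q. g q (Z q) (nabla T W q)) q"
        unfolding along_def[of U]
        using tangent_spaceD(1)[OF at[OF U] smooth_g[OF nabla[OF T Z] W] smooth_g[OF Z nabla[OF T W]]]
        by simp
      then show ?thesis by (simp only: compat U T Z W nabla)
    qed
    have "along (lie_bracket X Y) ?G q = along X (along Y ?G) q - along Y (along X ?G) q"
      by (simp add: along_lie_bracket)
    then have eq: "g q (nabla (lie_bracket X Y) Z q) (W q) + g q (Z q) (nabla (lie_bracket X Y) W q)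
        = g q (nabla X (nabla Y Z) q) (W q) + g q (Z q) (nabla X (nabla Y W) q)
        - g q (nabla Y (nabla X Z) q) (W q) - g q (Z q) (nabla Y (nabla X W) q)"
      unfolding second[OF X Y] second[OF Y X] compat[OF lie[OF X Y] Z W] by simp
    have split: "g q (curvature nabla X Y S q) (T q) = g q (nabla X (nabla Y S) q) (T q)
        - g q (nabla Y (nabla X S) q) (T q) - g q (nabla (lie_bracket X Y) S q) (T q)"
      if S: "vector_field A S" and T: "vector_field A T" for S T
      using gdiff[OF minus[OF nabla[OF X nabla[OF Y S]] nabla[OF Y nabla[OF X S]]]
          nabla[OF lie[OF X Y] S] T, of q]
        gdiff[OF nabla[OF X nabla[OF Y S]] nabla[OF Y nabla[OF X S]] T, of q]
      by (simp add: curvature_def)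
    note flip = gsym[OF at[OF Z] at[OF nabla[OF X nabla[OF Y W]]]]
      gsym[OF at[OF Z] at[OF nabla[OF Y nabla[OF X W]]]]
      gsym[OF at[OF Z] at[OF nabla[OF lie[OF X Y] W]]]
    show ?thesis using eq unfolding split[OF Z W] split[OF W Z] flip by simp
  qed
qed

section \<open>Cosymplectic HN-metric 3-structures\<close>

lemma almost_contact_3_structure_identities:
  assumes S: "almost_contact_3_structure A \<phi> \<xi> \<eta>"
  shows "\<alpha> \<in> {1, 2, 3} \<Longrightarrow> v \<in> tangent_space A p \<Longrightarrow> \<phi> \<alpha> p (\<phi> \<alpha> p v) = - v + \<eta> \<alpha> p v *\<^sub>R \<xi> \<alpha> p"
    and "v \<in> tangent_space A p \<Longrightarrow> \<phi> 2 p (\<phi> 3 p v) = \<eta> 3 p v *\<^sub>R \<xi> 2 p + \<phi> 1 p v"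
    and "v \<in> tangent_space A p \<Longrightarrow> \<phi> 3 p (\<phi> 2 p v) = \<eta> 2 p v *\<^sub>R \<xi> 3 p - \<phi> 1 p v"
    and "\<alpha> \<in> {1, 2, 3} \<Longrightarrow> \<phi> \<alpha> p (\<xi> \<alpha> p) = 0"
    and "\<alpha> \<in> {1, 2, 3} \<Longrightarrow> v \<in> tangent_space A p \<Longrightarrow> \<eta> \<alpha> p (\<phi> \<alpha> p v) = 0"
    and "\<alpha> \<in> {1, 2, 3} \<Longrightarrow> \<eta> \<alpha> p (\<xi> \<alpha> p) = 1"
proof -
  have comp: "\<phi> \<alpha> p (\<phi> \<beta> p v) = - (kronecker \<alpha> \<beta> *\<^sub>R v) + \<eta> \<beta> p v *\<^sub>R \<xi> \<alpha> p
      + (\<Sum>\<gamma>\<in>{1,2,3}. levi_civita_symbol \<alpha> \<beta> \<gamma> *\<^sub>R \<phi> \<gamma> p v)"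
    if "\<alpha> \<in> {1,2,3}" "\<beta> \<in> {1,2,3}" "v \<in> tangent_space A p" for \<alpha> \<beta> v
    using S that unfolding almost_contact_3_structure_def by blast
  have xi: "\<phi> \<alpha> p (\<xi> \<beta> p) = (\<Sum>\<gamma>\<in>{1,2,3}. levi_civita_symbol \<alpha> \<beta> \<gamma> *\<^sub>R \<xi> \<gamma> p)"
    and eta: "v \<in> tangent_space A p \<Longrightarrow>
      \<eta> \<alpha> p (\<phi> \<beta> p v) = (\<Sum>\<gamma>\<in>{1,2,3}. levi_civita_symbol \<alpha> \<beta> \<gamma> * \<eta> \<gamma> p v)"
    and eta_xi: "\<eta> \<alpha> p (\<xi> \<beta> p) = kronecker \<alpha> \<beta>"
    if "\<alpha> \<in> {1,2,3}" "\<beta> \<in> {1,2,3}" for \<alpha> \<beta> v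
    using S that unfolding almost_contact_3_structure_def by blast+
  have eps: "levi_civita_symbol \<alpha> \<alpha> \<gamma> = 0" for \<alpha> \<gamma>
    by (auto simp: levi_civita_symbol_def)
  have sum3: "(\<Sum>\<gamma>\<in>{1,2,3::nat}. f \<gamma>) = f 1 + f 2 + f 3" for f :: "nat \<Rightarrow> 'a tvec"
    by (rule ext) simp
  show "\<phi> \<alpha> p (\<phi> \<alpha> p v) = - v + \<eta> \<alpha> p v *\<^sub>R \<xi> \<alpha> p" if "\<alpha> \<in> {1, 2, 3}" "v \<in> tangent_space A p"
    using comp[OF that(1,1,2)] by (simp add: kronecker_def eps)
  show "\<phi> 2 p (\<phi> 3 p v) = \<eta> 3 p v *\<^sub>R \<xi> 2 p + \<phi> 1 p v" if "v \<in> tangent_space A p"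
    using comp[of 2 3, OF _ _ that] unfolding sum3 by (simp add: kronecker_def levi_civita_symbol_def)
  show "\<phi> 3 p (\<phi> 2 p v) = \<eta> 2 p v *\<^sub>R \<xi> 3 p - \<phi> 1 p v" if "v \<in> tangent_space A p"
    using comp[of 3 2, OF _ _ that] unfolding sum3 by (simp add: kronecker_def levi_civita_symbol_def)
  show "\<phi> \<alpha> p (\<xi> \<alpha> p) = 0" if "\<alpha> \<in> {1, 2, 3}"
    using xi[OF that that] by (simp add: eps)
  show "\<eta> \<alpha> p (\<phi> \<alpha> p v) = 0" if "\<alpha> \<in> {1, 2, 3}" "v \<in> tangent_space A p"
    using eta[OF that(1,1,2)] by (simp add: eps)
  show "\<eta> \<alpha> p (\<xi> \<alpha> p) = 1" if "\<alpha> \<in> {1, 2, 3}"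
    using eta_xi[OF that that] by (simp add: kronecker_def)
qed

lemma tangent_endomorphismD:
  assumes "tangent_endomorphism A \<phi>"
  shows "v \<in> tangent_space A p \<Longrightarrow> \<phi> p v \<in> tangent_space A p"
    and "v \<in> tangent_space A p \<Longrightarrow> w \<in> tangent_space A p \<Longrightarrow> \<phi> p (v + w) = \<phi> p v + \<phi> p w"
    and "vector_field A X \<Longrightarrow> vector_field A (apply_endo \<phi> X)"
  using assms by (simp_all add: tangent_endomorphism_def)

lemma pseudo_riemannian_metric_linear_right:
  assumes g: "pseudo_riemannian_metric A g"
    and v: "v \<in> tangent_space A p" and w: "w \<in> tangent_space A p"
  shows "u \<in> tangent_space A p \<Longrightarrow> g p w (u + v) = g p w u + g p w v"
    and "g p w (c *\<^sub>R v) = c * g p w v"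
proof -
  note sub = subspace_tangent_space[of A p]
  have sym: "g p x y = g p y x" if "x \<in> tangent_space A p" "y \<in> tangent_space A p" for x y
    using g that unfolding pseudo_riemannian_metric_def by blast
  show "g p w (u + v) = g p w u + g p w v" if u: "u \<in> tangent_space A p"
    unfolding sym[OF w subspace_add[OF sub u v]] sym[OF w u] sym[OF w v]
    using g[unfolded pseudo_riemannian_metric_def, THEN conjunct1] u v w by simp
  show "g p w (c *\<^sub>R v) = c * g p w v"
    unfolding sym[OF w subspace_scale[OF sub v]] sym[OF w v]
    using g[unfolded pseudo_riemannian_metric_def, THEN conjunct2, THEN conjunct1] v w by simp
qed

text \<open>Inserting \<open>Y = \<xi>\<^sub>\<alpha>\<close> into the metric condition shows that \<open>\<eta>\<^sub>\<alpha>\<close> is dual to \<open>\<xi>\<^sub>\<alpha>\<close> up to sign.  Inserting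
\<open>\<phi>\<^sub>\<alpha> Y\<close> for \<open>Y\<close>, with \<open>\<phi>\<^sub>\<alpha>\<^sup>2 = - I + \<xi>\<^sub>\<alpha> \<otimes> \<eta>\<^sub>\<alpha>\<close>, gives the second identity: \<open>\<phi>\<^sub>1\<close> is skew, \<open>\<phi>\<^sub>2\<close> and
\<open>\<phi>\<^sub>3\<close> are symmetric.\<close>

lemma hn_metric_identities:
  assumes S: "almost_contact_hn_metric_3_structure A \<phi> \<xi> \<eta> g" and \<alpha>: "\<alpha> \<in> {1, 2, 3}"
    and X: "vector_field A X"
  shows "\<eta> \<alpha> p (X p) = - hn_sign \<alpha> * g p (X p) (\<xi> \<alpha> p)"
    and "vector_field A Y \<Longrightarrow> g p (\<phi> \<alpha> p (X p)) (Y p) = - hn_sign \<alpha> * g p (X p) (\<phi> \<alpha> p (Y p))"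
proof -
  have AC: "almost_contact_3_structure A \<phi> \<xi> \<eta>" and g: "pseudo_riemannian_metric A g"
    and hn: "\<And>X Y p. vector_field A X \<Longrightarrow> vector_field A Y \<Longrightarrow> g p (\<phi> \<alpha> p (X p)) (\<phi> \<alpha> p (Y p))
          = hn_sign \<alpha> * g p (X p) (Y p) + \<eta> \<alpha> p (X p) * \<eta> \<alpha> p (Y p)"
    using S \<alpha> by (auto simp: almost_contact_hn_metric_3_structure_def hn_metric_def)
  have endo: "tangent_endomorphism A (\<phi> \<alpha>)" and \<xi>: "vector_field A (\<xi> \<alpha>)"
    using AC \<alpha> unfolding almost_contact_3_structure_def by blast+
  note \<phi>_field = tangent_endomorphismD(3)[OF endo] and \<phi>_in = tangent_endomorphismD(1)[OF endo]
  note id = almost_contact_3_structure_identities[OF AC]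
  note at = vector_fieldD(1)
  note sub = subspace_tangent_space[of A p]
  have sign: "hn_sign \<alpha> * hn_sign \<alpha> = 1" by (simp add: hn_sign_def)
  have eta: "\<eta> \<alpha> p (X p) = - hn_sign \<alpha> * g p (X p) (\<xi> \<alpha> p)" if X: "vector_field A X" for X
  proof -
    have "g p (\<phi> \<alpha> p (X p)) 0 = 0"
      using pseudo_riemannian_metric_linear_right(2)[OF g at[OF \<xi>] \<phi>_in[OF at[OF X]], where c = 0 and p = p]
      by simp
    then show ?thesis using hn[OF X \<xi>, of p] id(4,6)[OF \<alpha>, of p] by simp
  qed
  show "\<eta> \<alpha> p (X p) = - hn_sign \<alpha> * g p (X p) (\<xi> \<alpha> p)" by (rule eta[OF X])
  assume Y: "vector_field A Y"
  let ?u = "\<phi> \<alpha> p (X p)"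
  have u: "?u \<in> tangent_space A p" by (rule \<phi>_in[OF at[OF X]])
  \<comment> \<open>This product is a multiple of the value of the contact form on the image of its endomorphism.\<close>
  have "g p ?u (\<xi> \<alpha> p) = 0"
    using eta[OF \<phi>_field[OF X]] id(5)[OF \<alpha> at[OF X], of p] sign
    by (auto simp: apply_endo_def hn_sign_def split: if_splits)
  then have "g p ?u (- Y p + \<eta> \<alpha> p (Y p) *\<^sub>R \<xi> \<alpha> p) = - g p ?u (Y p)"
    using pseudo_riemannian_metric_linear_right(1)[OF g subspace_scale[OF sub at[OF \<xi>]] u
        subspace_neg[OF sub at[OF Y]], of "\<eta> \<alpha> p (Y p)"]
      pseudo_riemannian_metric_linear_right(2)[OF g at[OF \<xi>] u, where c = "\<eta> \<alpha> p (Y p)"]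
      pseudo_riemannian_metric_linear_right(2)[OF g at[OF Y] u, where c = "-1"]
    by simp
  moreover have "g p ?u (\<phi> \<alpha> p (\<phi> \<alpha> p (Y p))) = hn_sign \<alpha> * g p (X p) (\<phi> \<alpha> p (Y p))"
    using hn[OF X \<phi>_field[OF Y], of p] id(5)[OF \<alpha> at[OF Y], of p] by (simp add: apply_endo_def)
  ultimately show "g p ?u (Y p) = - hn_sign \<alpha> * g p (X p) (\<phi> \<alpha> p (Y p))"
    using id(1)[OF \<alpha> at[OF Y], of p] by simp
qed

lemma curvature_commutes_with_parallel_endomorphism:
  fixes A :: "('m::{t2_space,second_countable_topology}, 'e::euclidean_space) chart set"
  assumes M: "smooth_manifold A" and C: "affine_connection A nabla"
    and endo: "tangent_endomorphism A \<phi>"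
    and parallel: "\<And>X Y. vector_field A X \<Longrightarrow> vector_field A Y \<Longrightarrow> cov_deriv_endo nabla \<phi> X Y = 0"
    and X: "vector_field A X" and Y: "vector_field A Y" and Z: "vector_field A Z"
  shows "curvature nabla X Y (apply_endo \<phi> Z) = apply_endo \<phi> (curvature nabla X Y Z)"
proof -
  note nabla = affine_connectionD(1)[OF C]
  note lie = vector_field_lie_bracket[OF M X Y]
  note sub = subspace_vector_fields[OF M]
  have par: "nabla U (apply_endo \<phi> W) = apply_endo \<phi> (nabla U W)"
    if "vector_field A U" "vector_field A W" for U W
    using parallel[OF that] by (simp add: cov_deriv_endo_def)
  have add: "\<phi> p (u + v) = \<phi> p u + \<phi> p v" if "u \<in> tangent_space A p" "v \<in> tangent_space A p" for p u v
    by (rule tangent_endomorphismD(2)[OF endo that])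
  have diff: "apply_endo \<phi> (U - W) = apply_endo \<phi> U - apply_endo \<phi> W"
    if "vector_field A U" "vector_field A W" for U W
  proof
    fix p
    have "U p - W p \<in> tangent_space A p"
      using that by (intro subspace_diff[OF subspace_tangent_space] vector_fieldD(1))
    from add[OF this vector_fieldD(1)[OF that(2)]]
    show "apply_endo \<phi> (U - W) p = (apply_endo \<phi> U - apply_endo \<phi> W) p"
      by (simp add: apply_endo_def)
  qed
  have minus: "vector_field A (U - W)" if "vector_field A U" "vector_field A W" for U W
    using subspace_diff[OF sub] that by simp
  show ?thesis
    by (simp only: curvature_def par diff minus nabla lie X Y Z)
qed

lemma cosymplectic_endomorphisms_parallel:
  fixes A :: "('m::{t2_space,second_countable_topology}, 'e::euclidean_space) chart set"
  assumes M: "smooth_manifold A" and C: "affine_connection A nabla"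
    and S: "cosymplectic_hn_metric_3_structure A \<phi> \<xi> \<eta> g nabla" and \<alpha>: "\<alpha> \<in> {1, 2, 3}"
    and X: "vector_field A X" and Y: "vector_field A Y"
  shows "cov_deriv_endo nabla (\<phi> \<alpha>) X Y = 0"
proof -
  have g: "pseudo_riemannian_metric A g" and AC: "almost_contact_3_structure A \<phi> \<xi> \<eta>"
    and F: "\<And>Z p. vector_field A Z \<Longrightarrow> fundamental_tensor g nabla (\<phi> \<alpha>) X Y Z p = 0"
    using S \<alpha> X Y unfolding cosymplectic_hn_metric_3_structure_def
      almost_contact_hn_metric_3_structure_def hn_metric_def by blast+
  have "tangent_endomorphism A (\<phi> \<alpha>)"
    using AC \<alpha> unfolding almost_contact_3_structure_def by blast
  note endo = tangent_endomorphismD(3)[OF this]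
  have "vector_field A (cov_deriv_endo nabla (\<phi> \<alpha>) X Y)"
    using subspace_diff[OF subspace_vector_fields[OF M]] affine_connectionD(1)[OF C X] Y endo
    by (simp add: cov_deriv_endo_def)
  then show ?thesis
    by (rule metric_nondegenerate_on_vector_fields[OF M g])
      (use F in \<open>simp add: fundamental_tensor_def\<close>)
qed

theorem proposition6p2:
  fixes A :: "('m::{t2_space,second_countable_topology}, 'e::euclidean_space) chart set"
    and n :: nat
    and \<phi> :: "nat \<Rightarrow> 'm \<Rightarrow> 'm tvec \<Rightarrow> 'm tvec"
    and \<xi> :: "nat \<Rightarrow> 'm vfield"
    and \<eta> :: "nat \<Rightarrow> 'm \<Rightarrow> 'm tvec \<Rightarrow> real"
    and g :: "'m \<Rightarrow> 'm tvec \<Rightarrow> 'm tvec \<Rightarrow> real"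
    and nabla :: "'m vfield \<Rightarrow> 'm vfield \<Rightarrow> 'm vfield"
  assumes "smooth_manifold A"
    and "DIM('e) = 4 * n + 3"
    and "levi_civita_connection A g nabla"
    and "cosymplectic_hn_metric_3_structure A \<phi> \<xi> \<eta> g nabla"
  shows "flat A nabla"
proof -
  note M = assms(1) and LC = assms(3) and S = assms(4)
  have S': "almost_contact_hn_metric_3_structure A \<phi> \<xi> \<eta> g"
    and AC: "almost_contact_3_structure A \<phi> \<xi> \<eta>" and g: "pseudo_riemannian_metric A g"
    using S by (auto simp: cosymplectic_hn_metric_3_structure_def
        almost_contact_hn_metric_3_structure_def hn_metric_def)
  have C: "affine_connection A nabla" using LC by (simp add: levi_civita_connection_def)
  let ?V = "{X. vector_field A X}"
  let ?R = "curvature nabla"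
  let ?G = "\<lambda>X Y q. g q (X q) (Y q)"
  let ?J = "\<lambda>\<alpha>. apply_endo (\<phi> \<alpha>)"
  interpret curvature_operator ?V ?G ?R
    by (rule curvature_operator_levi_civita[OF M g LC])
  note id = almost_contact_3_structure_identities[OF AC]
  note at = vector_fieldD(1)
  have endo: "tangent_endomorphism A (\<phi> \<alpha>)" and \<xi>: "\<xi> \<alpha> \<in> ?V" if "\<alpha> \<in> {1,2,3}" for \<alpha>
    using AC that unfolding almost_contact_3_structure_def by blast+
  have J_in: "?J \<alpha> X \<in> ?V" if "\<alpha> \<in> {1,2,3}" "X \<in> ?V" for \<alpha> X
    using tangent_endomorphismD(3)[OF endo[OF that(1)]] that(2) by simp
  have J_add: "?J \<alpha> (X + Y) = ?J \<alpha> X + ?J \<alpha> Y" if "\<alpha> \<in> {1,2,3}" "X \<in> ?V" "Y \<in> ?V" for \<alpha> X Y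
  proof
    fix p
    have "\<phi> \<alpha> p (X p + Y p) = \<phi> \<alpha> p (X p) + \<phi> \<alpha> p (Y p)"
      using that(2,3) by (intro tangent_endomorphismD(2)[OF endo[OF that(1)]] at) simp_all
    then show "?J \<alpha> (X + Y) p = (?J \<alpha> X + ?J \<alpha> Y) p" by (simp add: apply_endo_def)
  qed
  have commute: "?R X Y (?J \<alpha> Z) = ?J \<alpha> (?R X Y Z)"
    if "\<alpha> \<in> {1,2,3}" "X \<in> ?V" "Y \<in> ?V" "Z \<in> ?V" for \<alpha> X Y Z
    by (rule curvature_commutes_with_parallel_endomorphism[OF M C endo[OF that(1)]
          cosymplectic_endomorphisms_parallel[OF M C S that(1)]]) (use that in auto)
  have G_J: "?G (?J \<alpha> X) Y q = - hn_sign \<alpha> * ?G X (?J \<alpha> Y) q"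
    if "\<alpha> \<in> {1,2,3}" "X \<in> ?V" "Y \<in> ?V" for \<alpha> X Y q
    using hn_metric_identities(2)[OF S' that(1), of X Y q] that(2,3) by (simp add: apply_endo_def)
  have J_J: "?J \<alpha> (?J \<alpha> X) = - X + fun_scale (\<lambda>q. \<eta> \<alpha> q (X q)) (\<xi> \<alpha>)"
    if "\<alpha> \<in> {1,2,3}" "X \<in> ?V" for \<alpha> X
    using id(1)[OF that(1) at] that(2) by (intro ext) (simp add: apply_endo_def fun_scale_def)
  \<comment> \<open>First R(X,Y) annihilates the Reeb field; by duality the contact form then
    annihilates the image of R(X,Y).\<close>
  have eta_zero: "\<eta> \<alpha> q (?R X Y Z q) = 0"
    if \<alpha>: "\<alpha> \<in> {1,2,3}" and XYZ: "X \<in> ?V" "Y \<in> ?V" "Z \<in> ?V" for \<alpha> X Y Z q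
  proof -
    note R\<xi>_in = R_in[OF XYZ(1,2) \<xi>[OF \<alpha>]]
    have eta: "\<eta> \<alpha> q (U q) = - hn_sign \<alpha> * ?G U (\<xi> \<alpha>) q" if "U \<in> ?V" for U q
      using hn_metric_identities(1)[OF S' \<alpha>] that by simp
    have "?J \<alpha> (\<xi> \<alpha>) = 0" using id(4)[OF \<alpha>] by (intro ext) (simp add: apply_endo_def)
    then have "?J \<alpha> (?R X Y (\<xi> \<alpha>)) = 0"
      using commute[OF \<alpha> XYZ(1,2) \<xi>[OF \<alpha>]] R_zero[OF XYZ(1,2)] by simp
    moreover have "?J \<alpha> 0 = 0" using J_add[OF \<alpha>, of 0 0] V_closed(4) by simp
    ultimately have "?R X Y (\<xi> \<alpha>) = fun_scale (\<lambda>q. \<eta> \<alpha> q (?R X Y (\<xi> \<alpha>) q)) (\<xi> \<alpha>)"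
      using J_J[OF \<alpha> R\<xi>_in] by (simp add: neg_eq_iff_add_eq_0)
    moreover have "\<eta> \<alpha> q (?R X Y (\<xi> \<alpha>) q) = 0" for q
      using eta[OF R\<xi>_in, of q] R_skew[OF XYZ(1,2) \<xi>[OF \<alpha>] \<xi>[OF \<alpha>], of q] by simp
    ultimately have "?R X Y (\<xi> \<alpha>) = 0" by (simp add: fun_scale_def fun_eq_iff)
    then have "?G (?R X Y Z) (\<xi> \<alpha>) q = - ?G 0 Z q"
      using R_skew[OF XYZ \<xi>[OF \<alpha>], of q] by simp
    also have "\<dots> = 0" using g_zero[OF XYZ(3), of q] by simp
    finally show ?thesis using eta[OF R_in[OF XYZ], of q] by simp
  qed
  have R_tangent: "?R X Y Z q \<in> tangent_space A q" if "X \<in> ?V" "Y \<in> ?V" "Z \<in> ?V" for X Y Z q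
    using R_in[OF that] by (intro at) simp
  have "?R X Y Z = 0" if XYZ: "X \<in> ?V" "Y \<in> ?V" "Z \<in> ?V" for X Y Z
  proof (rule quaternionic_curvature_vanishes[of "?J 1" "?J 2" "?J 3", OF _ _ _ _ _ _ _ _ _ _ _ _ _ _ _ XYZ])
    fix X Y Z :: "'m vfield" and q
    assume X: "X \<in> ?V"
    show "?J 1 X \<in> ?V" "?J 2 X \<in> ?V" "?J 3 X \<in> ?V" by (rule J_in[OF _ X], simp)+
    assume Y: "Y \<in> ?V"
    show "?J 1 (X + Y) = ?J 1 X + ?J 1 Y" "?J 2 (X + Y) = ?J 2 X + ?J 2 Y"
      "?J 3 (X + Y) = ?J 3 X + ?J 3 Y"
      by (rule J_add[OF _ X Y], simp)+
    show "?G (?J 1 X) Y q = - ?G X (?J 1 Y) q" "?G (?J 2 X) Y q = ?G X (?J 2 Y) q"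
      "?G (?J 3 X) Y q = ?G X (?J 3 Y) q"
      using G_J[of 1 X Y q] G_J[of 2 X Y q] G_J[of 3 X Y q] X Y by (simp_all add: hn_sign_def)
    assume Z: "Z \<in> ?V"
    show "?R X Y (?J 1 Z) = ?J 1 (?R X Y Z)" "?R X Y (?J 2 Z) = ?J 2 (?R X Y Z)"
      "?R X Y (?J 3 Z) = ?J 3 (?R X Y Z)"
      by (rule commute[OF _ X Y Z], simp)+
    have eta: "\<eta> 1 p (?R X Y Z p) = 0" "\<eta> 2 p (?R X Y Z p) = 0" "\<eta> 3 p (?R X Y Z p) = 0" for p
      by (rule eta_zero[OF _ X Y Z], simp)+
    note T = R_tangent[OF X Y Z]
    show "?J 1 (?J 1 (?R X Y Z)) = - ?R X Y Z"
      using id(1)[of 1, OF _ T] eta by (intro ext) (simp add: apply_endo_def)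
    show "?J 2 (?J 3 (?R X Y Z)) = ?J 1 (?R X Y Z)"
      using id(2)[OF T] eta by (intro ext) (simp add: apply_endo_def)
    show "?J 3 (?J 2 (?R X Y Z)) = - ?J 1 (?R X Y Z)"
      using id(3)[OF T] eta by (intro ext) (simp add: apply_endo_def)
  qed
  then show ?thesis by (simp add: flat_def)
qed

end
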